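(* If $\alpha$ is an uncountable regular cardinal in $L$ (i.e., $L\models$ "$\alpha$ is an uncountable regular cardinal"), then there are no constructible $\alpha$-wITRM-recognizable subsets of $\alpha$.
   Context: Machines. An $\alpha$-register machine program is an ordinary register machine program: a finite list of numbered lines using finitely many registers, each register containing an ordinal $<\alpha$. Commands: increment a register by $1$; copy one register to another; jump to a given line if two register contents agree (otherwise go to the next line); oracle command: for an oracle $x\subseteq\alpha$, replace the content $\iota$ of register $j$ by $1$ if $\iota\in x$ and by $0$ otherwise. Computations run along the ordinals: at successor times the active command is carried out; at limit times the index of the active program line and each register content are the inferior limits of the sequences of their earlier values. If such an inferior limit of register contents equals $\alpha$ (overflow), the computation of an $\alpha$-wITRM is undefined. Inputs and parameters are written in the first registers, all other registers start with $0$. $P^{x}(\vec\xi)\downarrow=c$ means that $P$ with oracle $x$ and input $\vec\xi$ halts with $c$ in the output register. A set $x\subseteq\alpha$ is $\alpha$-wITRM-recognizable if there are an $\alpha$-wITRM-program $P$ and a parameter $\xi<\alpha$ such that, for all $y\subseteq\alpha$, $P^{y}(\xi)$ is defined and halts with output $1$ if $y=x$ and with output $0$ if $y\neq x$. *)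

theory Defs
  imports Complex_Main
begin

text \<open>The ambient set-theoretic universe: a type of sets satisfying second-order ZF. Choice holds
  automatically, by replacement along choice functions of HOL. HOL sets over such a type play the
  role of classes.\<close>

class zfc_universe =
  fixes elts :: "'a \<Rightarrow> 'a set"
  assumes extensionality: "elts x = elts y \<Longrightarrow> x = y"
    and separation: "X \<subseteq> elts x \<Longrightarrow> \<exists>z. elts z = X"
    and union: "\<exists>z. elts z = (\<Union>y\<in>elts x. elts y)"
    and powerset: "\<exists>z. elts z = {y. elts y \<subseteq> elts x}"
    and replacement: "\<exists>z. elts z = f ` elts x"
    and infinity: "\<exists>z. elts z = range (g :: nat \<Rightarrow> 'a)"
    and foundation: "wf {(x, y). x \<in> elts y}"

definition vset :: "'v::zfc_universe set \<Rightarrow> 'v" where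
  "vset X = (THE z. elts z = X)"

definition zero :: "'v::zfc_universe" where
  "zero = vset {}"

definition succ :: "'v::zfc_universe \<Rightarrow> 'v" where
  "succ a = vset (insert a (elts a))"

definition transitive :: "'v::zfc_universe \<Rightarrow> bool" where
  "transitive a \<longleftrightarrow> (\<forall>b\<in>elts a. elts b \<subseteq> elts a)"

definition Ord :: "'v::zfc_universe \<Rightarrow> bool" where
  "Ord a \<longleftrightarrow> transitive a \<and> (\<forall>b\<in>elts a. transitive b)"

definition Limit :: "'v::zfc_universe \<Rightarrow> bool" where
  "Limit a \<longleftrightarrow> Ord a \<and> a \<noteq> zero \<and> (\<forall>b\<in>elts a. succ b \<in> elts a)"


section \<open>The constructible universe\<close>

datatype fm = Mem nat nat | Eq nat nat | Neg fm | Conj fm fm | Exi nat fm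

primrec free_vars :: "fm \<Rightarrow> nat set" where
  "free_vars (Mem i j) = {i, j}"
| "free_vars (Eq i j) = {i, j}"
| "free_vars (Neg p) = free_vars p"
| "free_vars (Conj p q) = free_vars p \<union> free_vars q"
| "free_vars (Exi i p) = free_vars p - {i}"

primrec sat :: "'v::zfc_universe set \<Rightarrow> (nat \<Rightarrow> 'v) \<Rightarrow> fm \<Rightarrow> bool" where
  "sat A s (Mem i j) \<longleftrightarrow> s i \<in> elts (s j)"
| "sat A s (Eq i j) \<longleftrightarrow> s i = s j"
| "sat A s (Neg p) \<longleftrightarrow> \<not> sat A s p"
| "sat A s (Conj p q) \<longleftrightarrow> sat A s p \<and> sat A s q"
| "sat A s (Exi i p) \<longleftrightarrow> (\<exists>a\<in>A. sat A (s(i := a)) p)"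

text \<open>The subsets of \<open>A\<close> first-order definable over \<open>(A, \<in>)\<close> with parameters from \<open>A\<close>;
  variable 0 is the one being abstracted.\<close>

definition Def :: "'v::zfc_universe set \<Rightarrow> 'v set" where
  "Def A = {x. \<exists>p s. (\<forall>i\<in>free_vars p - {0}. s i \<in> A) \<and> elts x = {a\<in>A. sat A (s(0 := a)) p}}"

text \<open>Since \<open>\<beta> \<mapsto> Def (Lset \<beta>)\<close> is increasing on the ordinals, this single clause amounts to the usual
  zero, successor and limit clauses.\<close>

function Lset :: "'v::zfc_universe \<Rightarrow> 'v set" where
  "Lset \<beta> = (\<Union>\<gamma>\<in>elts \<beta>. Def (Lset \<gamma>))"
  by auto
termination
  by (relation "{(x, y). x \<in> elts y}") (simp_all add: foundation)

declare Lset.simps [simp del]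

definition L :: "'v::zfc_universe set" where
  "L = (\<Union>\<beta>\<in>Collect Ord. Lset \<beta>)"


section \<open>Relativization to a class\<close>

text \<open>For \<open>a, b, \<dots> \<in> M\<close>, each predicate below says that the structure \<open>(M, \<in>)\<close> satisfies the
  corresponding formula of set theory: every quantifier is restricted to \<open>M\<close>.
  Ordered pairs are Kuratowski pairs.\<close>

definition upair_rel :: "'v::zfc_universe set \<Rightarrow> 'v \<Rightarrow> 'v \<Rightarrow> 'v \<Rightarrow> bool" where
  "upair_rel M a b z \<longleftrightarrow> (\<forall>x\<in>M. x \<in> elts z \<longleftrightarrow> x = a \<or> x = b)"

definition pair_rel :: "'v::zfc_universe set \<Rightarrow> 'v \<Rightarrow> 'v \<Rightarrow> 'v \<Rightarrow> bool" where
  "pair_rel M a b z \<longleftrightarrow>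
     (\<exists>u\<in>M. \<exists>w\<in>M. upair_rel M a a u \<and> upair_rel M a b w \<and> upair_rel M u w z)"

definition app_rel :: "'v::zfc_universe set \<Rightarrow> 'v \<Rightarrow> 'v \<Rightarrow> 'v \<Rightarrow> bool" where
  "app_rel M f a b \<longleftrightarrow> (\<exists>z\<in>M. pair_rel M a b z \<and> z \<in> elts f)"

definition function_rel :: "'v::zfc_universe set \<Rightarrow> 'v \<Rightarrow> 'v \<Rightarrow> 'v \<Rightarrow> bool" where
  "function_rel M f A B \<longleftrightarrow>
     (\<forall>z \<in> M \<inter> elts f. \<exists>a \<in> M \<inter> elts A. \<exists>b \<in> M \<inter> elts B. pair_rel M a b z) \<and>
     (\<forall>a \<in> M \<inter> elts A. \<exists>!b. b \<in> M \<and> app_rel M f a b)"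

definition injection_rel :: "'v::zfc_universe set \<Rightarrow> 'v \<Rightarrow> 'v \<Rightarrow> 'v \<Rightarrow> bool" where
  "injection_rel M f A B \<longleftrightarrow> function_rel M f A B \<and>
     (\<forall>a \<in> M \<inter> elts A. \<forall>a' \<in> M \<inter> elts A. \<forall>b \<in> M. app_rel M f a b \<and> app_rel M f a' b \<longrightarrow> a = a')"

definition bijection_rel :: "'v::zfc_universe set \<Rightarrow> 'v \<Rightarrow> 'v \<Rightarrow> 'v \<Rightarrow> bool" where
  "bijection_rel M f A B \<longleftrightarrow> injection_rel M f A B \<and>
     (\<forall>b \<in> M \<inter> elts B. \<exists>a \<in> M \<inter> elts A. app_rel M f a b)"

definition transitive_rel :: "'v::zfc_universe set \<Rightarrow> 'v \<Rightarrow> bool" where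
  "transitive_rel M a \<longleftrightarrow> (\<forall>b \<in> M \<inter> elts a. \<forall>c \<in> M \<inter> elts b. c \<in> elts a)"

definition ordinal_rel :: "'v::zfc_universe set \<Rightarrow> 'v \<Rightarrow> bool" where
  "ordinal_rel M a \<longleftrightarrow> transitive_rel M a \<and> (\<forall>b \<in> M \<inter> elts a. transitive_rel M b)"

definition limit_ordinal_rel :: "'v::zfc_universe set \<Rightarrow> 'v \<Rightarrow> bool" where
  "limit_ordinal_rel M a \<longleftrightarrow> ordinal_rel M a \<and> (\<exists>b\<in>M. b \<in> elts a) \<and>
     (\<forall>b \<in> M \<inter> elts a. \<exists>c \<in> M \<inter> elts a. b \<in> elts c)"

definition omega_rel :: "'v::zfc_universe set \<Rightarrow> 'v \<Rightarrow> bool" where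
  "omega_rel M a \<longleftrightarrow> limit_ordinal_rel M a \<and> (\<forall>b \<in> M \<inter> elts a. \<not> limit_ordinal_rel M b)"

definition countable_rel :: "'v::zfc_universe set \<Rightarrow> 'v \<Rightarrow> bool" where
  "countable_rel M a \<longleftrightarrow> (\<exists>w\<in>M. omega_rel M w \<and> (\<exists>f\<in>M. injection_rel M f a w))"

definition cardinal_rel :: "'v::zfc_universe set \<Rightarrow> 'v \<Rightarrow> bool" where
  "cardinal_rel M a \<longleftrightarrow> ordinal_rel M a \<and>
     (\<forall>b \<in> M \<inter> elts a. \<not> (\<exists>f\<in>M. bijection_rel M f b a))"

definition cofinal_map_rel :: "'v::zfc_universe set \<Rightarrow> 'v \<Rightarrow> 'v \<Rightarrow> 'v \<Rightarrow> bool" where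
  "cofinal_map_rel M f b a \<longleftrightarrow> function_rel M f b a \<and>
     (\<forall>c \<in> M \<inter> elts a. \<exists>d \<in> M \<inter> elts b. \<exists>e\<in>M. app_rel M f d e \<and> (c = e \<or> c \<in> elts e))"

definition regular_rel :: "'v::zfc_universe set \<Rightarrow> 'v \<Rightarrow> bool" where
  "regular_rel M a \<longleftrightarrow> (\<forall>b \<in> M \<inter> elts a. \<not> (\<exists>f\<in>M. cofinal_map_rel M f b a))"

definition uncountable_regular_cardinal_rel :: "'v::zfc_universe set \<Rightarrow> 'v \<Rightarrow> bool" where
  "uncountable_regular_cardinal_rel M a \<longleftrightarrow>
     a \<in> M \<and> cardinal_rel M a \<and> \<not> countable_rel M a \<and> regular_rel M a"


section \<open>Weak infinite time register machines\<close>

text \<open>\<open>Copy i j\<close> writes the content of register \<open>i\<close> into register \<open>j\<close>; \<open>JumpEq i j k\<close> jumps to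
  line \<open>k\<close> if registers \<open>i\<close> and \<open>j\<close> agree. Lines are numbered from 0. Configurations carry a
  register for each natural number, but a program only ever changes the finitely many it mentions.\<close>

datatype command = Inc nat | Copy nat nat | JumpEq nat nat nat | Oracle nat

type_synonym program = "command list"

type_synonym 'v config = "nat \<times> (nat \<Rightarrow> 'v)"

abbreviation active_line :: "'v config \<Rightarrow> nat" where "active_line \<equiv> fst"
abbreviation regs :: "'v config \<Rightarrow> nat \<Rightarrow> 'v" where "regs \<equiv> snd"

text \<open>The machine has halted when the active line is not a line of the program.\<close>

definition halted :: "program \<Rightarrow> 'v config \<Rightarrow> bool" where
  "halted P C \<longleftrightarrow> length P \<le> active_line C"

fun exec :: "'v::zfc_universe \<Rightarrow> command \<Rightarrow> 'v config \<Rightarrow> 'v config" where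
  "exec x (Inc i) (l, r) = (Suc l, r(i := succ (r i)))"
| "exec x (Copy i j) (l, r) = (Suc l, r(j := r i))"
| "exec x (JumpEq i j k) (l, r) = (if r i = r j then k else Suc l, r)"
| "exec x (Oracle j) (l, r) = (Suc l, r(j := if r j \<in> elts x then succ zero else zero))"

definition step :: "program \<Rightarrow> 'v::zfc_universe \<Rightarrow> 'v config \<Rightarrow> 'v config" where
  "step P x C = (if halted P C then C else exec x (P ! active_line C) C)"

text \<open>For an ordinal \<open>\<mu>\<close> and \<open>\<sigma> < \<mu>\<close>, the set \<open>elts \<mu> - elts \<sigma>\<close> is the interval \<open>[\<sigma>, \<mu>)\<close>. Infima and
  suprema of sets of ordinals are intersections and unions, so both components are inferior limits
  \<open>sup\<close> over \<open>\<sigma> < \<mu>\<close> of \<open>inf\<close> over \<open>[\<sigma>, \<mu>)\<close>. The line indices of a run of a finite program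
  are bounded, so the supremum over the natural numbers is a genuine one.\<close>

definition limit_config :: "'v::zfc_universe \<Rightarrow> ('v \<Rightarrow> 'v config) \<Rightarrow> 'v config" where
  "limit_config \<mu> c =
     (SUP \<sigma>\<in>elts \<mu>. INF \<rho>\<in>elts \<mu> - elts \<sigma>. active_line (c \<rho>),
      \<lambda>i. vset (\<Union>\<sigma>\<in>elts \<mu>. \<Inter>\<rho>\<in>elts \<mu> - elts \<sigma>. elts (regs (c \<rho>) i)))"

definition start_config :: "'v::zfc_universe list \<Rightarrow> 'v config" where
  "start_config \<xi>s = (0, \<lambda>i. if i < length \<xi>s then \<xi>s ! i else zero)"

text \<open>\<open>c\<close>, restricted to times \<open>\<le> \<tau>\<close>, is the computation of \<open>P\<close> with oracle \<open>x\<close> and input \<open>\<xi>s\<close>.\<close>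

definition computation ::
    "program \<Rightarrow> 'v::zfc_universe \<Rightarrow> 'v list \<Rightarrow> 'v \<Rightarrow> ('v \<Rightarrow> 'v config) \<Rightarrow> bool" where
  "computation P x \<xi>s \<tau> c \<longleftrightarrow>
     c zero = start_config \<xi>s \<and>
     (\<forall>\<sigma>\<in>elts \<tau>. c (succ \<sigma>) = step P x (c \<sigma>)) \<and>
     (\<forall>\<mu>\<in>elts (succ \<tau>). Limit \<mu> \<longrightarrow> c \<mu> = limit_config \<mu> c)"

text \<open>The computation halts at some time \<open>\<tau>\<close>, with no overflow up to then, and register 0, the
  output register, contains \<open>v\<close>.\<close>

definition wITRM_halts_with ::
    "'v::zfc_universe \<Rightarrow> program \<Rightarrow> 'v \<Rightarrow> 'v list \<Rightarrow> 'v \<Rightarrow> bool" where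
  "wITRM_halts_with \<alpha> P x \<xi>s v \<longleftrightarrow>
     (\<exists>\<tau> c. Ord \<tau> \<and> computation P x \<xi>s \<tau> c \<and>
        (\<forall>\<sigma>\<in>elts (succ \<tau>). \<forall>i. regs (c \<sigma>) i \<in> elts \<alpha>) \<and>
        halted P (c \<tau>) \<and> regs (c \<tau>) 0 = v)"

definition wITRM_recognizable :: "'v::zfc_universe \<Rightarrow> 'v \<Rightarrow> bool" where
  "wITRM_recognizable \<alpha> x \<longleftrightarrow> elts x \<subseteq> elts \<alpha> \<and>
     (\<exists>P. \<exists>\<xi>\<in>elts \<alpha>. \<forall>y. elts y \<subseteq> elts \<alpha> \<longrightarrow>
        wITRM_halts_with \<alpha> P y [\<xi>] (if y = x then succ zero else zero))"

end

theory Submission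
  imports Defs
begin

text \<open>Let \<open>P\<close> with parameter \<open>\<xi>\<close> recognize a constructible \<open>x\<close>. The run of \<open>P\<close> with oracle \<open>x\<close> is
  definable over \<open>L\<close> by recursion, so regularity of \<open>\<alpha>\<close> in \<open>L\<close> applies to it, whatever the
  cofinality of \<open>\<alpha>\<close> in the universe. If the run reached time \<open>\<alpha>\<close>, every register would from some
  time on stay above its value at time \<open>\<alpha>\<close> and take that value cofinally often; an
  \<open>\<omega>\<close>-iteration inside \<open>L\<close> (here \<open>\<alpha>\<close> is uncountable) produces \<open>\<mu> < \<alpha>\<close> with the same
  configuration, and the machine loops forever. Hence the run halts before \<open>\<alpha>\<close>, its register contents
  are bounded by some \<open>\<gamma> < \<alpha>\<close>, and the oracle is never asked about \<open>\<gamma>\<close>. Changing \<open>x\<close> at \<open>\<gamma>\<close> only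
  then yields a second set which \<open>P\<close> accepts.\<close>

section \<open>Small collections and ordinals\<close>

text \<open>Every appeal to regularity inside L needs a function whose graph is an element of L, and
  this shapes most of the development. Definability over L is treated semantically: \<open>D\<close>
  and \<open>DT\<close> are HOL predicates on predicates and terms over assignments, with closure
  rules for logic and for the set operations, so that definability of a long recursion reduces to
  applying introduction rules. L is a proper class, so separation for such predicates has to descend
  to a level; this is the job of reflection. Two occurrences of the same configuration do not by
  themselves trap the machine, since the inferior limit of repeated passes may drop below the
  repeated configuration. This is why \<mu> is chosen so late that no register falls below its limit
  value between \<mu> and \<alpha>. Absence of overflow enters here as well: if the run lasts until
  \<alpha>, its register contents at time \<alpha> are below \<alpha>, so that regularity can bound
  functions defined on them.\<close>

definition small :: "'v::zfc_universe set \<Rightarrow> bool" where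
  "small X \<longleftrightarrow> (\<exists>z. elts z = X)"

lemma elts_inject: "elts x = elts y \<longleftrightarrow> x = (y::'v::zfc_universe)"
  using extensionality by blast

lemma elts_vset [simp]: "small X \<Longrightarrow> elts (vset X) = X"
  unfolding small_def vset_def by (rule theI') (auto simp: elts_inject)

lemma small_elts [simp]: "small (elts x)"
  by (auto simp: small_def)

lemma vset_elts [simp]: "vset (elts x) = x"
  using elts_inject elts_vset small_elts by blast

lemma vset_eqI: "small X \<Longrightarrow> elts y = X \<Longrightarrow> vset X = y"
  by auto

lemma small_subset: "small Y \<Longrightarrow> X \<subseteq> Y \<Longrightarrow> small X"
  unfolding small_def using separation by blast

lemma small_Collect [simp]: "small {x \<in> elts a. Q x}"
  by (rule small_subset[of "elts a"]) auto

lemma small_image [intro, simp]: "small X \<Longrightarrow> small (f ` X)"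
  for f :: "'v::zfc_universe \<Rightarrow> 'v"
  unfolding small_def using replacement by blast

lemma small_UN [intro, simp]:
  fixes F :: "'v::zfc_universe \<Rightarrow> 'v set"
  assumes "small X" "\<And>x. x \<in> X \<Longrightarrow> small (F x)"
  shows "small (\<Union>x\<in>X. F x)"
proof -
  obtain z where z: "elts z = (\<lambda>x. vset (F x)) ` X"
    using small_image[OF assms(1), of "\<lambda>x. vset (F x)"] unfolding small_def by blast
  obtain u where "elts u = (\<Union>y\<in>elts z. elts y)" using union by blast
  then have "elts u = (\<Union>x\<in>X. F x)" using z assms(2) by auto
  then show ?thesis unfolding small_def by blast
qed

lemma small_range [simp]: "small (range g)" for g :: "nat \<Rightarrow> 'v::zfc_universe"
  unfolding small_def using infinity by blast

lemma small_UN_nat [simp]: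
  fixes F :: "nat \<Rightarrow> 'v::zfc_universe set"
  assumes "\<And>n. small (F n)"
  shows "small (\<Union>n. F n)"
proof -
  have "(\<Union>n. F n) = (\<Union>y\<in>range (\<lambda>n. vset (F n)). elts y)" using assms by auto
  then show ?thesis by (metis (no_types, lifting) small_UN small_elts small_range)
qed

lemma small_empty [simp]: "small {}"
  by (rule small_subset[of "elts undefined"]) auto

lemma small_Un [simp]: "small X \<Longrightarrow> small Y \<Longrightarrow> small (X \<union> Y)"
proof -
  assume "small X" "small Y"
  then have "small (\<Union>n::nat. if n = 0 then X else Y)" by (intro small_UN_nat) auto
  moreover have "(\<Union>n::nat. if n = 0 then X else Y) = X \<union> Y" by (auto split: if_splits)
  ultimately show ?thesis by simp
qed

lemma small_insert [simp]: "small X \<Longrightarrow> small (insert a X)"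
proof -
  assume "small X"
  have "{a} = range (\<lambda>n::nat. a)" by auto
  then have "small {a}" by (metis small_range)
  then have "small ({a} \<union> X)" using \<open>small X\<close> by (rule small_Un)
  then show ?thesis by simp
qed

lemma small_finite: "finite X \<Longrightarrow> small X"
  by (induction X rule: finite_induct) auto

lemma small_Pow: "small X \<Longrightarrow> small {y. elts y \<subseteq> X}"
  unfolding small_def using powerset by metis

lemma eps_induct: "(\<And>x. (\<And>y. y \<in> elts x \<Longrightarrow> Q y) \<Longrightarrow> Q x) \<Longrightarrow> Q (x::'v::zfc_universe)"
  using wf_induct_rule[OF foundation, of Q x] by simp

lemma mem_irrefl [simp]: "x \<notin> elts (x::'v::zfc_universe)"
  using wf_irrefl[OF foundation] by force

lemma mem_asym: "x \<in> elts y \<Longrightarrow> y \<notin> elts (x::'v::zfc_universe)"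
  using wf_asym[OF foundation, of x y] by simp

lemma elts_zero [simp]: "elts zero = {}"
  by (simp add: zero_def)

lemma elts_succ [simp]: "elts (succ a) = insert a (elts a)"
  by (simp add: succ_def)

lemma zero_iff: "a = zero \<longleftrightarrow> elts a = {}"
  by (metis elts_inject elts_zero)

lemma succ_ne_zero [simp]: "succ a \<noteq> zero" "zero \<noteq> succ a"
  by (simp_all add: zero_iff) (metis elts_succ elts_zero insert_not_empty)

lemma succ_inject [simp]: "succ a = succ b \<longleftrightarrow> a = (b::'v::zfc_universe)"
proof
  assume "succ a = succ b"
  then have "insert a (elts a) = insert b (elts b)" by (metis elts_succ)
  then show "a = b" using mem_asym by (metis insert_iff)
qed simp

section \<open>Ordinals\<close>

lemma Ord_transD: "Ord a \<Longrightarrow> b \<in> elts a \<Longrightarrow> c \<in> elts b \<Longrightarrow> c \<in> elts a"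
  unfolding Ord_def transitive_def by blast

lemma Ord_in_Ord: "Ord a \<Longrightarrow> b \<in> elts a \<Longrightarrow> Ord b"
  unfolding Ord_def transitive_def by blast

lemma OrdI: "(\<And>b. b \<in> elts a \<Longrightarrow> Ord b) \<Longrightarrow> (\<And>b c. b \<in> elts a \<Longrightarrow> c \<in> elts b \<Longrightarrow> c \<in> elts a) \<Longrightarrow> Ord a"
  unfolding Ord_def transitive_def by blast

lemma Ord_zero [simp]: "Ord zero"
  by (rule OrdI) auto

lemma Ord_succ [simp]: "Ord (succ a) \<longleftrightarrow> Ord a"
proof
  show "Ord (succ a) \<Longrightarrow> Ord a" by (rule Ord_in_Ord[of "succ a"]) simp_all
  show "Ord a \<Longrightarrow> Ord (succ a)" by (rule OrdI) (auto intro: Ord_in_Ord Ord_transD)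
qed

text \<open>Nested membership induction: if no case of the trichotomy held, the induction hypotheses
  would give inclusion in both directions, hence \<open>a = b\<close> by extensionality.\<close>

lemma Ord_linear: "Ord a \<Longrightarrow> Ord b \<Longrightarrow> a \<in> elts b \<or> a = b \<or> b \<in> elts a"
proof (induction a arbitrary: b rule: eps_induct)
  case (1 a)
  note IHa = 1
  show ?case using IHa(3)
  proof (induction b rule: eps_induct)
    case (1 b)
    show ?case
    proof (rule ccontr)
      assume neg: "\<not> ?thesis"
      have "elts a \<subseteq> elts b"
      proof
        fix c assume c: "c \<in> elts a"
        have "c \<in> elts b \<or> c = b \<or> b \<in> elts c"
          using IHa(1)[OF c Ord_in_Ord[OF IHa(2) c] 1(2)] .
        then show "c \<in> elts b" using neg c Ord_transD[OF IHa(2) c] by blast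
      qed
      moreover have "elts b \<subseteq> elts a"
      proof
        fix c assume c: "c \<in> elts b"
        have "a \<in> elts c \<or> a = c \<or> c \<in> elts a"
          using 1(1)[OF c Ord_in_Ord[OF 1(2) c]] .
        then show "c \<in> elts a" using neg c Ord_transD[OF 1(2) c] by blast
      qed
      ultimately show False using neg extensionality by blast
    qed
  qed
qed

lemma Ord_subset_iff: "Ord a \<Longrightarrow> Ord b \<Longrightarrow> elts a \<subseteq> elts b \<longleftrightarrow> a \<in> elts b \<or> a = b"
  by (metis Ord_linear Ord_transD mem_irrefl order_refl subsetD subsetI)

lemma Ord_not_in: "Ord a \<Longrightarrow> Ord b \<Longrightarrow> a \<notin> elts b \<longleftrightarrow> elts b \<subseteq> elts a"
  by (metis Ord_linear Ord_subset_iff mem_irrefl subsetD)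

lemma Ord_UN: "small X \<Longrightarrow> (\<And>x. x \<in> X \<Longrightarrow> Ord x) \<Longrightarrow> Ord (vset (\<Union>x\<in>X. elts x))"
  by (rule OrdI) (auto dest: Ord_in_Ord Ord_transD)

lemma Ord_Un: "Ord a \<Longrightarrow> Ord b \<Longrightarrow> Ord (vset (elts a \<union> elts b))"
  by (rule OrdI) (auto dest: Ord_in_Ord Ord_transD)

lemma Ord_Un_mem:
  assumes "Ord a" "b \<in> elts a" "c \<in> elts a"
  shows "vset (elts b \<union> elts c) \<in> elts a"
proof -
  have "Ord b" "Ord c" using assms Ord_in_Ord by blast+
  then have "elts b \<subseteq> elts c \<or> elts c \<subseteq> elts b" using Ord_not_in Ord_subset_iff by blast
  then show ?thesis using assms by (auto simp: Un_absorb1 Un_absorb2)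
qed

lemma LimitD: "Limit a \<Longrightarrow> Ord a" "Limit a \<Longrightarrow> b \<in> elts a \<Longrightarrow> succ b \<in> elts a" "Limit a \<Longrightarrow> zero \<in> elts a"
  unfolding Limit_def
  using Ord_linear[of zero a] by auto

lemma Limit_not_succ: "\<not> Limit (succ a)" "\<not> Limit zero"
proof -
  show "\<not> Limit (succ a)"
  proof
    assume "Limit (succ a)"
    then have "succ a \<in> elts (succ a)" unfolding Limit_def by (metis elts_succ insertI1)
    then show False by (metis mem_irrefl)
  qed
qed (simp add: Limit_def)

lemma Ord_cases:
  assumes "Ord a"
  obtains "a = zero" | b where "Ord b" "a = succ b" | "Limit a"
proof (cases "a = zero \<or> Limit a")
  case False
  then obtain b where b: "b \<in> elts a" "succ b \<notin> elts a"
    using assms unfolding Limit_def by blast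
  have "Ord b" using assms b Ord_in_Ord by blast
  then have "succ b = a" using Ord_linear[OF _ assms, of "succ b"] b mem_asym by auto
  then show ?thesis using that(2) \<open>Ord b\<close> by blast
next
  case True
  then show ?thesis using that(1,3) by blast
qed

lemma Ord_mem_zero: "Ord a \<Longrightarrow> a \<noteq> zero \<Longrightarrow> zero \<in> elts a"
  by (metis Ord_linear Ord_zero elts_zero empty_iff)

lemma Ord_in_succ_iff: "Ord a \<Longrightarrow> Ord b \<Longrightarrow> a \<in> elts (succ b) \<longleftrightarrow> elts a \<subseteq> elts b"
  by (metis Ord_subset_iff elts_succ insert_iff)

lemma Ord_succ_mem_succ: "Ord b \<Longrightarrow> a \<in> elts b \<Longrightarrow> succ a \<in> elts (succ b)"
proof -
  assume b: "Ord b" and a: "a \<in> elts b"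
  have oa: "Ord a" using a b Ord_in_Ord by blast
  have "succ b \<notin> elts (succ a)"
  proof
    assume "succ b \<in> elts (succ a)"
    then have "b \<in> elts (succ a)" using oa Ord_transD[of "succ a" "succ b" b] by simp
    then show False using a mem_asym[OF a] by auto
  qed
  moreover have "succ a \<noteq> succ b" using a by auto
  ultimately show ?thesis using Ord_linear[of "succ a" "succ b"] oa b by (simp del: elts_succ)
qed

lemma Ord_least:
  assumes "Ord a" "Q a"
  obtains b where "Ord b" "Q b" "\<And>c. c \<in> elts b \<Longrightarrow> \<not> Q c" "elts b \<subseteq> elts a"
proof -
  have "\<exists>b. Ord b \<and> Q b \<and> (\<forall>c\<in>elts b. \<not> Q c) \<and> elts b \<subseteq> elts a"
    using assms
  proof (induction a rule: eps_induct)
    case (1 a)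
    show ?case
    proof (cases "\<exists>c\<in>elts a. Q c")
      case True
      then obtain c where c: "c \<in> elts a" "Q c" by blast
      then obtain b where "Ord b \<and> Q b \<and> (\<forall>c\<in>elts b. \<not> Q c) \<and> elts b \<subseteq> elts c"
        using 1 Ord_in_Ord by meson
      then show ?thesis using c 1(2) Ord_transD by blast
    qed (use 1 in blast)
  qed
  then show ?thesis using that by blast
qed

section \<open>Von Neumann numerals, \<omega> and Kuratowski pairs\<close>

definition num :: "nat \<Rightarrow> 'v::zfc_universe" where
  "num n = (succ ^^ n) zero"

lemma num_simps [simp]: "num 0 = zero" "num (Suc n) = succ (num n)"
  by (simp_all add: num_def)

lemma elts_num: "elts (num n) = num ` {..<n}"
  by (induction n) (auto simp: lessThan_Suc)

lemma Ord_num [simp]: "Ord (num n)"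
  by (induction n) auto

lemma num_mem [simp]: "num m \<in> elts (num n :: 'v::zfc_universe) \<longleftrightarrow> m < n"
proof
  have *: "num k \<in> elts (num l :: 'v)" if "k < l" for k l
    using that by (simp add: elts_num)
  show "m < n \<Longrightarrow> num m \<in> elts (num n :: 'v)" by (rule *)
  show "m < n" if "num m \<in> elts (num n :: 'v)"
  proof (rule ccontr)
    assume "\<not> m < n"
    then have "n = m \<or> n < m" by linarith
    then show False using that *[of n m] mem_asym mem_irrefl by metis
  qed
qed

lemma num_inject [simp]: "num m = (num n :: 'v::zfc_universe) \<longleftrightarrow> m = n"
  by (metis mem_irrefl nat_neq_iff num_mem)

definition omega :: "'v::zfc_universe" where
  "omega = vset (range num)"

lemma elts_omega [simp]: "elts omega = range num"
  by (simp add: omega_def)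

lemma Limit_omega: "Limit omega"
  unfolding Limit_def zero_iff
proof (intro conjI ballI)
  show "Ord (omega :: 'a)" by (rule OrdI) (auto simp: elts_num)
  show "succ b \<in> elts omega" if "b \<in> elts omega" for b :: 'a
    using that by (auto intro: range_eqI[of _ _ "Suc _"])
qed auto

definition upair :: "'v::zfc_universe \<Rightarrow> 'v \<Rightarrow> 'v" where
  "upair a b = vset {a, b}"

definition pair :: "'v::zfc_universe \<Rightarrow> 'v \<Rightarrow> 'v" where
  "pair a b = upair (upair a a) (upair a b)"

lemma elts_upair [simp]: "elts (upair a b) = {a, b}"
  by (simp add: upair_def)

lemma pair_inject [simp]: "pair a b = pair c d \<longleftrightarrow> a = c \<and> b = d"
  unfolding pair_def by (auto simp flip: elts_inject simp: doubleton_eq_iff)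

text \<open>On ordinals this is ordinal addition: the single clause
  \<open>a + b = a \<union> {a + d | d < b}\<close> covers zero, successor and limit arguments
  alike.\<close>

function oadd :: "'v::zfc_universe \<Rightarrow> 'v \<Rightarrow> 'v" where
  "oadd a b = vset (elts a \<union> oadd a ` elts b)"
  by auto
termination
  by (relation "inv_image {(x, y). x \<in> elts y} snd") (simp_all add: foundation)

declare oadd.simps [simp del]

lemma elts_oadd: "elts (oadd a b) = elts a \<union> oadd a ` elts b"
  by (subst oadd.simps) simp

lemma oadd_zero [simp]: "oadd a zero = a"
  by (metis elts_inject elts_oadd elts_zero image_empty sup_bot.right_neutral)

lemma oadd_succ [simp]: "oadd a (succ b) = succ (oadd a b)"
  by (auto simp flip: elts_inject simp: elts_oadd)

lemma Ord_oadd [simp]: "Ord a \<Longrightarrow> Ord b \<Longrightarrow> Ord (oadd a b)"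
proof (induction b rule: eps_induct)
  case (1 b)
  show ?case
  proof (rule OrdI)
    fix c assume "c \<in> elts (oadd a b)"
    then show "Ord c" using 1 Ord_in_Ord by (auto simp: elts_oadd)
    fix d assume "d \<in> elts c"
    with \<open>c \<in> elts (oadd a b)\<close> show "d \<in> elts (oadd a b)" 
      using 1(2,3) Ord_transD by (auto simp: elts_oadd)
  qed
qed

lemma oadd_mono: "b \<in> elts c \<Longrightarrow> oadd a b \<in> elts (oadd a c)"
  by (auto simp: elts_oadd)

lemma oadd_mem_iff: "Ord a \<Longrightarrow> Ord b \<Longrightarrow> Ord c \<Longrightarrow> oadd a b \<in> elts (oadd a c) \<longleftrightarrow> b \<in> elts c"
  by (metis Ord_linear mem_asym oadd_mono)

lemma subset_oadd: "Ord a \<Longrightarrow> Ord x \<Longrightarrow> elts x \<subseteq> elts (oadd a x)"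
proof (induction x rule: eps_induct)
  case (1 x)
  show ?case
  proof
    fix y assume y: "y \<in> elts x"
    have oy: "Ord y" using y 1 Ord_in_Ord by blast
    then have "elts y \<subseteq> elts (oadd a y)" using 1 y by blast
    then have "y \<in> elts (oadd a y) \<or> y = oadd a y"
      by (metis Ord_subset_iff[OF oy Ord_oadd[OF \<open>Ord a\<close> oy]])
    then show "y \<in> elts (oadd a x)"
      using oadd_mono[OF y] Ord_transD[of "oadd a x"] \<open>Ord x\<close> \<open>Ord a\<close> by force
  qed
qed

text \<open>Left subtraction, which turns a time after \<open>a\<close> into a duration. The
  remainder collects the \<open>d\<close> with \<open>a + d < r\<close>; they can be sought inside
  \<open>r\<close> because \<open>d \<le> a + d\<close> by \<open>subset_oadd\<close>.\<close>

lemma oadd_surj: "Ord a \<Longrightarrow> Ord r \<Longrightarrow> elts a \<subseteq> elts r \<Longrightarrow> \<exists>b. Ord b \<and> oadd a b = r"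
proof (induction r rule: eps_induct)
  case (1 r)
  show ?case
  proof -
    define b where "b = vset {d \<in> elts r. oadd a d \<in> elts r}"
    have eb: "elts b = {d \<in> elts r. oadd a d \<in> elts r}" by (simp add: b_def)
    have ordb: "Ord b"
      by (rule OrdI) (use eb 1(3) Ord_in_Ord Ord_transD oadd_mono in \<open>blast+\<close>)
    have sub: "elts (oadd a b) \<subseteq> elts r"
      using 1(4) eb by (auto simp: elts_oadd)
    moreover have "elts r \<subseteq> elts (oadd a b)"
    proof
      fix c assume c: "c \<in> elts r"
      have oc: "Ord c" using c 1(3) Ord_in_Ord by blast
      show "c \<in> elts (oadd a b)"
      proof (cases "c \<in> elts a")
        case False
        then have "elts a \<subseteq> elts c" using Ord_not_in oc 1(2) by blast
        then obtain d where d: "Ord d" "oadd a d = c" using 1 c oc by blast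
        have "d \<in> elts r"
        proof (rule ccontr)
          assume "d \<notin> elts r"
          have "c \<notin> elts d"
          proof
            assume "c \<in> elts d"
            then show False using d subset_oadd[OF \<open>Ord a\<close>] by (metis mem_irrefl subsetD)
          qed
          then have "d \<in> elts c \<or> d = c" using Ord_linear oc d by blast
          then show False using \<open>d \<notin> elts r\<close> c 1(3) Ord_transD by blast
        qed
        then have "d \<in> elts b" using d c by (simp add: eb)
        then show ?thesis using d oadd_mono by blast
      qed (simp add: elts_oadd)
    qed
    ultimately show ?thesis using ordb elts_inject by blast
  qed
qed

lemma Limit_oadd:
  assumes "Ord a" "Limit b"
  shows "Limit (oadd a b)"
  unfolding Limit_def
proof (intro conjI ballI)
  show "Ord (oadd a b)" using assms by (blast intro: Ord_oadd LimitD(1))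
  have z: "a \<in> elts (oadd a b)" using oadd_mono[OF LimitD(3)[OF assms(2)], of a] by simp
  then show "oadd a b \<noteq> zero" by auto
  fix c assume "c \<in> elts (oadd a b)"
  then consider "c \<in> elts a" | d where "d \<in> elts b" "c = oadd a d" by (auto simp: elts_oadd)
  then show "succ c \<in> elts (oadd a b)"
  proof cases
    case 1
    then have "succ c \<in> elts (succ a)" using Ord_succ_mem_succ assms(1) by blast
    then show ?thesis using z Ord_transD[OF \<open>Ord (oadd a b)\<close>] by auto
  next
    case 2
    then show ?thesis using oadd_mono[OF LimitD(2)[OF assms(2) 2(1)], of a] by simp
  qed
qed

section \<open>The constructible hierarchy and reflection\<close>

lemma Lset_iff: "x \<in> Lset b \<longleftrightarrow> (\<exists>c\<in>elts b. x \<in> Def (Lset c))"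
  by (subst Lset.simps) auto

lemma Def_subset: "x \<in> Def A \<Longrightarrow> elts x \<subseteq> A"
  by (auto simp: Def_def)

lemma small_Lset [simp]: "small (Lset b)"
proof (induction b rule: eps_induct)
  case (1 b)
  have "small (Def (Lset c))" if "c \<in> elts b" for c
    by (rule small_subset[OF small_Pow[OF 1[OF that]]]) (use Def_subset in blast)
  then show ?case by (subst Lset.simps) (rule small_UN, simp_all)
qed

lemma Lset_mono: "elts a \<subseteq> elts b \<Longrightarrow> Lset a \<subseteq> Lset b"
  unfolding subset_iff Lset_iff[of _ a] Lset_iff[of _ b] by blast

lemma Def_Lset_succ: "Def (Lset b) \<subseteq> Lset (succ b)"
  by (auto simp: Lset_iff[of _ "succ b"])

lemma Lset_transD: "Ord b \<Longrightarrow> x \<in> Lset b \<Longrightarrow> y \<in> elts x \<Longrightarrow> y \<in> Lset b"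
proof -
  assume "Ord b" "x \<in> Lset b" "y \<in> elts x"
  then obtain c where c: "c \<in> elts b" "x \<in> Def (Lset c)" by (auto simp: Lset_iff[of _ b])
  then have "y \<in> Lset c" using Def_subset \<open>y \<in> elts x\<close> by blast
  moreover have "elts c \<subseteq> elts b" using c \<open>Ord b\<close> Ord_transD by blast
  ultimately show ?thesis using Lset_mono by blast
qed

lemma L_iff: "x \<in> L \<longleftrightarrow> (\<exists>b. Ord b \<and> x \<in> Lset b)"
  by (auto simp: L_def)

lemma L_trans: "x \<in> L \<Longrightarrow> y \<in> elts x \<Longrightarrow> y \<in> L"
  using L_iff Lset_transD by blast

lemma Def_Lset_L: "Ord b \<Longrightarrow> Def (Lset b) \<subseteq> L"
  using Def_Lset_succ Ord_succ L_iff by blast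

lemma Lset_in_L: "Ord b \<Longrightarrow> vset (Lset b) \<in> L"
proof -
  assume "Ord b"
  have "vset (Lset b) \<in> Def (Lset b)"
    unfolding Def_def by (rule CollectI, rule exI[of _ "Eq 0 0"]) simp
  then show ?thesis using Def_Lset_L \<open>Ord b\<close> by blast
qed

text \<open>By replacement, a choice of stages for the members has a small image, and the union of
  that image is an ordinal stage that contains them all.\<close>

lemma small_subset_Lset:
  assumes "small X" "X \<subseteq> L"
  obtains b where "Ord b" "X \<subseteq> Lset b"
proof -
  define f where "f x = (SOME b. Ord b \<and> x \<in> Lset b)" for x :: 'a
  have f: "Ord (f x) \<and> x \<in> Lset (f x)" if "x \<in> X" for x
    unfolding f_def by (rule someI_ex) (use that assms L_iff in blast)
  let ?Y = "f ` X"
  have sY: "small ?Y" by (simp add: assms)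
  define b where "b = vset (\<Union>y\<in>?Y. elts y)"
  have "Ord b" unfolding b_def by (rule Ord_UN[OF sY]) (use f in auto)
  moreover have "X \<subseteq> Lset b"
  proof
    fix x assume x: "x \<in> X"
    have "elts b = (\<Union>y\<in>?Y. elts y)" unfolding b_def by (rule elts_vset, rule small_UN[OF sY]) simp
    then have "elts (f x) \<subseteq> elts b" using x by blast
    then show "x \<in> Lset b" using f[OF x] Lset_mono by blast
  qed
  ultimately show ?thesis using that by blast
qed

lemma zero_L [simp]: "zero \<in> L"
  using Lset_in_L[of zero] by (simp add: Lset.simps[of zero] vset_eqI flip: zero_def)

definition closed_under :: "('v::zfc_universe \<Rightarrow> 'v) \<Rightarrow> 'v \<Rightarrow> bool" where
  "closed_under F b \<longleftrightarrow> Limit b \<and> (\<forall>c\<in>elts b. F c \<in> elts b)"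

text \<open>The ordinal is the limit of an \<omega>-sequence that starts above \<open>a\<close>,
  each term exceeding all values of \<open>F\<close> on the previous one.\<close>

lemma ex_closed_under:
  assumes F: "\<And>c. Ord c \<Longrightarrow> Ord (F c)" and a: "Ord a"
  obtains b where "closed_under F b" "a \<in> elts b"
proof -
  \<comment> \<open>\<open>F\<close> is not assumed monotone, so a single value \<open>F c\<close>
    need not dominate the values on members of \<open>c\<close>; \<open>U c\<close> does.\<close>
  define U where "U c = vset (elts c \<union> (\<Union>d\<in>elts c. elts (F d)))" for c
  have eU: "elts (U c) = elts c \<union> (\<Union>d\<in>elts c. elts (F d))" for c by (simp add: U_def)
  have oU: "Ord (U c)" if "Ord c" for c
  proof (rule OrdI)
    fix x assume "x \<in> elts (U c)"
    then have x: "x \<in> elts c \<or> (\<exists>d\<in>elts c. x \<in> elts (F d))" using eU by blast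
    have oF: "Ord (F d)" if "d \<in> elts c" for d
      using F[OF Ord_in_Ord[OF \<open>Ord c\<close> that]] .
    show "Ord x" using x oF Ord_in_Ord \<open>Ord c\<close> by metis
    fix y assume y: "y \<in> elts x"
    have "y \<in> elts c \<or> (\<exists>d\<in>elts c. y \<in> elts (F d))"
      using x oF Ord_transD[OF _ _ y] \<open>Ord c\<close> by metis
    then show "y \<in> elts (U c)" unfolding eU by blast
  qed
  define g where "g = rec_nat (succ a) (\<lambda>_ c. succ (U c))"
  have g0: "g 0 = succ a" and gS: "g (Suc n) = succ (U (g n))" for n by (simp_all add: g_def)
  have og: "Ord (g n)" for n by (induction n) (simp_all add: g0 gS a oU)
  have g1: "g n \<in> elts (g (Suc n))" for n
    unfolding gS using Ord_in_succ_iff[OF og oU[OF og], of n n] eU by blast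
  have g2: "F c \<in> elts (g (Suc n))" if "c \<in> elts (g n)" for c n
  proof -
    have "Ord (F c)" using F og Ord_in_Ord that by blast
    then show ?thesis unfolding gS using Ord_in_succ_iff[OF _ oU[OF og], of "F c" n] eU that by blast
  qed
  define b where "b = vset (\<Union>x\<in>range g. elts x)"
  have eb: "elts b = (\<Union>n. elts (g n))" by (simp add: b_def)
  have "Limit b" unfolding Limit_def
  proof (intro conjI ballI)
    show "Ord b" unfolding b_def by (rule Ord_UN) (use og in auto)
    have "a \<in> elts (g 0)" by (simp add: g0)
    then have "a \<in> elts b" using eb by blast
    then show "b \<noteq> zero" by auto
    fix c assume "c \<in> elts b"
    then obtain n where n: "c \<in> elts (g n)" by (auto simp: eb)
    then have "succ c \<in> elts (succ (g n))" using Ord_succ_mem_succ og by blast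
    then have "succ c \<in> elts (g (Suc n))" using g1 Ord_transD[OF og] by (metis elts_succ insert_iff)
    then show "succ c \<in> elts b" using eb by blast
  qed
  moreover have "\<forall>c\<in>elts b. F c \<in> elts b" unfolding eb by (auto intro: g2)
  moreover have "a \<in> elts (g 0)" by (simp add: g0)
  then have "a \<in> elts b" unfolding eb by blast
  ultimately show ?thesis using that[of b] unfolding closed_under_def by simp
qed

text \<open>Sequences are HOL functions, not sets. Coding each by its graph, a subset of the set
  \<open>S\<close>, puts them inside a power set, and replacement applies to \<open>h\<close> after
  decoding. This bounds witnesses over all assignments into a level of L.\<close>

lemma small_image_seq:
  fixes h :: "(nat \<Rightarrow> 'v::zfc_universe) \<Rightarrow> 'v"
  assumes "small X"
  shows "small (h ` {s. \<forall>n. s n \<in> X})"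
proof -
  define S where "S = (\<Union>n. pair (num n) ` X)"
  have sS: "small S" unfolding S_def using assms by simp
  define dec where "dec z = (\<lambda>n. THE y. pair (num n) y \<in> elts z)" for z :: 'v
  have "h ` {s. \<forall>n. s n \<in> X} \<subseteq> (\<lambda>z. h (dec z)) ` {z. elts z \<subseteq> S}"
  proof
    fix w assume "w \<in> h ` {s. \<forall>n. s n \<in> X}"
    then obtain s where s: "w = h s" "\<And>n. s n \<in> X" by blast
    define z where "z = vset (range (\<lambda>n. pair (num n) (s n)))"
    have ez: "elts z = range (\<lambda>n. pair (num n) (s n))" by (simp add: z_def)
    have "dec z = s" unfolding dec_def ez by (rule ext, rule the_equality) auto
    moreover have "elts z \<subseteq> S" unfolding ez S_def using s by auto
    ultimately show "w \<in> (\<lambda>z. h (dec z)) ` {z. elts z \<subseteq> S}" using s by blast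
  qed
  then show ?thesis using small_subset small_image small_Pow[OF sS] by blast
qed

lemma sat_cong: "(\<And>n. n \<in> free_vars p \<Longrightarrow> s n = t n) \<Longrightarrow> sat A s p \<longleftrightarrow> sat A t p"
proof (induction p arbitrary: s t)
  case (Neg p)
  have "sat A s p \<longleftrightarrow> sat A t p" by (rule Neg.IH) (use Neg.prems in simp)
  then show ?case by simp
next
  case (Conj p q)
  then show ?case by (metis UnCI free_vars.simps(4) sat.simps(4))
next
  case (Exi i p)
  have "sat A (s(i := a)) p \<longleftrightarrow> sat A (t(i := a)) p" for a
    by (rule Exi.IH) (use Exi.prems in auto)
  then show ?case by simp
qed auto

lemma finite_free_vars [simp]: "finite (free_vars p)"
  by (induction p) auto

lemma Lset_Limit: "Limit b \<Longrightarrow> x \<in> Lset b \<Longrightarrow> \<exists>c\<in>elts b. x \<in> Lset c"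
  using Lset_iff[of x b] Def_Lset_succ LimitD(2) by blast

lemma Lset_Limit_finite:
  assumes "Limit b" "finite N" "\<And>n. n \<in> N \<Longrightarrow> s n \<in> Lset b"
  shows "\<exists>c\<in>elts b. \<forall>n\<in>N. s n \<in> Lset c"
  using assms(2,3)
proof (induction N rule: finite_induct)
  case empty
  then show ?case using LimitD(3)[OF assms(1)] by blast
next
  case (insert m N)
  then obtain c where c: "c \<in> elts b" "\<forall>n\<in>N. s n \<in> Lset c" by blast
  obtain d where d: "d \<in> elts b" "s m \<in> Lset d" using Lset_Limit assms(1) insert by blast
  let ?u = "vset (elts c \<union> elts d)"
  have "?u \<in> elts b" using Ord_Un_mem LimitD(1)[OF assms(1)] c d by blast
  moreover have "Lset c \<subseteq> Lset ?u" "Lset d \<subseteq> Lset ?u" by (rule Lset_mono, simp)+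
  ultimately show ?case using c d by blast
qed

text \<open>The function \<open>F\<close> stands for the closed unbounded class of its closure
  points. Functions are easier to combine than classes: closure under the pointwise union of two of
  them gives closure under both.\<close>

definition reflects :: "('v::zfc_universe \<Rightarrow> 'v) \<Rightarrow> fm \<Rightarrow> bool" where
  "reflects F p \<longleftrightarrow> (\<forall>c. Ord c \<longrightarrow> Ord (F c)) \<and> (\<forall>b. closed_under F b \<longrightarrow>
    (\<forall>s. (\<forall>n\<in>free_vars p. s n \<in> Lset b) \<longrightarrow> (sat (Lset b) s p \<longleftrightarrow> sat L s p)))"

lemma reflectsD:
  assumes "reflects F p"
  shows "Ord c \<Longrightarrow> Ord (F c)"
    and "closed_under F b \<Longrightarrow> (\<And>n. n \<in> free_vars p \<Longrightarrow> s n \<in> Lset b) \<Longrightarrow> sat (Lset b) s p \<longleftrightarrow> sat L s p"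
  using assms unfolding reflects_def by simp_all

lemma reflectsI:
  assumes "\<And>c. Ord c \<Longrightarrow> Ord (F c)"
    and "\<And>b s. closed_under F b \<Longrightarrow> \<forall>n\<in>free_vars p. s n \<in> Lset b \<Longrightarrow> sat (Lset b) s p \<longleftrightarrow> sat L s p"
  shows "reflects F p"
  using assms unfolding reflects_def by blast

lemma closed_under_Un:
  assumes F: "\<And>c. Ord c \<Longrightarrow> Ord (F c)" and G: "\<And>c. Ord c \<Longrightarrow> Ord (G c)"
    and b: "closed_under (\<lambda>c. vset (elts (F c) \<union> elts (G c))) b"
  shows "closed_under F b \<and> closed_under G b"
proof -
  have ob: "Ord b" using b LimitD unfolding closed_under_def by blast
  have "F c \<in> elts b \<and> G c \<in> elts b" if c: "c \<in> elts b" for c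
  proof -
    have oc: "Ord c" using ob c Ord_in_Ord by blast
    let ?h = "vset (elts (F c) \<union> elts (G c))"
    have h: "?h \<in> elts b" using b c unfolding closed_under_def by blast
    have sub: "elts (F c) \<subseteq> elts ?h" "elts (G c) \<subseteq> elts ?h" by auto
    have oh: "Ord ?h" using h ob Ord_in_Ord by blast
    have "x \<in> elts b" if "Ord x" "elts x \<subseteq> elts ?h" for x
      using Ord_subset_iff[OF that(1) oh] that(2) h Ord_transD[OF ob h, of x] by metis
    then show ?thesis using F[OF oc] G[OF oc] sub by blast
  qed
  then show ?thesis using b unfolding closed_under_def by blast
qed

text \<open>Only the quantifier needs a new function: \<open>G c\<close> bounds the stages at which
  witnesses appear for assignments into \<open>Lset c\<close>, so a level closed under it contains a
  witness whenever L does.\<close>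

lemma reflection: "\<exists>F::'v::zfc_universe \<Rightarrow> 'v. reflects F p"
proof (induction p)
  case (Mem i j)
  show ?case by (rule exI[of _ "\<lambda>x. x"]) (simp add: reflects_def)
next
  case (Eq i j)
  show ?case by (rule exI[of _ "\<lambda>x. x"]) (simp add: reflects_def)
next
  case (Neg p)
  then show ?case by (simp add: reflects_def)
next
  case (Conj p q)
  then obtain F G :: "'v \<Rightarrow> 'v" where F: "reflects F p" and G: "reflects G q" by blast
  let ?H = "\<lambda>c. vset (elts (F c) \<union> elts (G c))"
  have "reflects ?H (Conj p q)"
  proof (rule reflectsI)
    show "Ord (?H c)" if "Ord c" for c using reflectsD(1)[OF F that] reflectsD(1)[OF G that] by (rule Ord_Un)
    fix b :: 'v and s assume b: "closed_under ?H b" and s: "\<forall>n\<in>free_vars (Conj p q). s n \<in> Lset b"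
    have "closed_under F b \<and> closed_under G b"
      using closed_under_Un[OF reflectsD(1)[OF F] reflectsD(1)[OF G] b] .
    then show "sat (Lset b) s (Conj p q) \<longleftrightarrow> sat L s (Conj p q)"
      using reflectsD(2)[OF F, of b s] reflectsD(2)[OF G, of b s] s by simp
  qed
  then show ?case by blast
next
  case (Exi i p)
  then obtain F :: "'v \<Rightarrow> 'v" where F: "reflects F p" by blast
  define h :: "(nat \<Rightarrow> 'v) \<Rightarrow> 'v" where
    "h s = (SOME b. Ord b \<and> ((\<exists>a\<in>L. sat L (s(i := a)) p) \<longrightarrow> (\<exists>a\<in>Lset b. sat L (s(i := a)) p)))" for s
  have h: "Ord (h s) \<and> ((\<exists>a\<in>L. sat L (s(i := a)) p) \<longrightarrow> (\<exists>a\<in>Lset (h s). sat L (s(i := a)) p))" for s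
    unfolding h_def
    by (rule someI_ex) (use L_iff Ord_zero in blast)
  define X where "X c = h ` {s. \<forall>n. s n \<in> insert zero (Lset c)}" for c
  have sX: "small (X c)" for c unfolding X_def by (rule small_image_seq) simp
  define G where "G c = vset (\<Union>x\<in>X c. elts x)" for c
  have eG: "elts (G c) = (\<Union>x\<in>X c. elts x)" for c
    unfolding G_def by (rule elts_vset, rule small_UN[OF sX]) simp
  have oG: "Ord (G c)" for c unfolding G_def by (rule Ord_UN[OF sX]) (use h in \<open>auto simp: X_def\<close>)
  let ?H = "\<lambda>c. vset (elts (F c) \<union> elts (G c))"
  have clos: "closed_under F b \<and> closed_under G b" if b: "closed_under ?H b" for b
    using closed_under_Un[OF reflectsD(1)[OF F] oG that] .
  have "sat (Lset b) s (Exi i p) \<longleftrightarrow> sat L s (Exi i p)"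
    if b: "closed_under ?H b" and s: "\<forall>n\<in>free_vars (Exi i p). s n \<in> Lset b" for b s
  proof -
    have lb: "Limit b" using b by (simp add: closed_under_def)
    have sub: "Lset b \<subseteq> L" using LimitD(1)[OF lb] L_iff by blast
    have eq: "sat (Lset b) (s(i := a)) p \<longleftrightarrow> sat L (s(i := a)) p" if "a \<in> Lset b" for a
      by (rule reflectsD(2)[OF F]) (use clos[OF b] s that in auto)
    have "\<exists>a\<in>Lset b. sat L (s(i := a)) p" if ex: "\<exists>a\<in>L. sat L (s(i := a)) p"
    proof -
      \<comment> \<open>The values of \<open>s\<close> are controlled only on the free variables.
        These are finitely many, hence their values lie in one \<open>Lset c\<close> with
        \<open>c < b\<close>, and \<open>t\<close> agrees with \<open>s\<close> there.\<close>
      define t where "t n = (if n \<in> free_vars (Exi i p) then s n else zero)" for n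
      have ts: "sat L (s(i := a)) p \<longleftrightarrow> sat L (t(i := a)) p" for a
        by (rule sat_cong) (auto simp: t_def)
      have "\<exists>c\<in>elts b. \<forall>n\<in>free_vars (Exi i p). s n \<in> Lset c"
        by (rule Lset_Limit_finite[OF lb finite_free_vars]) (rule s[rule_format])
      then obtain c where c: "c \<in> elts b" "\<forall>n\<in>free_vars (Exi i p). s n \<in> Lset c" ..
      have "h t \<in> X c" unfolding X_def using c(2) by (auto simp: t_def)
      then have "elts (h t) \<subseteq> elts (G c)" using eG by blast
      moreover have "G c \<in> elts b" using clos[OF b] c unfolding closed_under_def by blast
      ultimately have "elts (h t) \<subseteq> elts b" using LimitD(1)[OF lb] Ord_transD by blast
      then show ?thesis using h[of t] ex ts Lset_mono by blast
    qed
    then show ?thesis using eq sub by auto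
  qed
  moreover have "Ord (?H c)" if "Ord c" for c using reflectsD(1)[OF F that] oG by (rule Ord_Un)
  ultimately have "reflects ?H (Exi i p)" by (intro reflectsI)
  then show ?case by blast
qed

section \<open>Definability over L\<close>

definition Lenv :: "(nat \<Rightarrow> 'v::zfc_universe) \<Rightarrow> bool" where
  "Lenv s \<longleftrightarrow> (\<forall>n. s n \<in> L)"

text \<open>Even slots of an assignment hold the variables, odd slots the parameters.\<close>

definition mix :: "(nat \<Rightarrow> 'v) \<Rightarrow> (nat \<Rightarrow> 'v) \<Rightarrow> nat \<Rightarrow> 'v" where
  "mix s e n = (if even n then s (n div 2) else e (n div 2))"

lemma mix_simps [simp]: "mix s e (2 * n) = s n" "mix s e (Suc (2 * n)) = e n" "mix s e 0 = s 0"
  by (simp_all add: mix_def)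

lemma Lenv_mix [simp]: "Lenv s \<Longrightarrow> Lenv e \<Longrightarrow> Lenv (mix s e)"
  by (simp add: Lenv_def mix_def)

lemma Lenv_ren: "Lenv s \<Longrightarrow> Lenv (\<lambda>n. s (f n))"
  by (simp add: Lenv_def)

lemma Lenv_Suc [simp]: "Lenv s \<Longrightarrow> Lenv (\<lambda>n. s (Suc n))"
  by (rule Lenv_ren)

lemma Lenv_case [simp]: "Lenv s \<Longrightarrow> x \<in> L \<Longrightarrow> Lenv (case_nat x s)"
  by (simp add: Lenv_def split: nat.split)

lemma Lenv_at [simp]: "Lenv s \<Longrightarrow> s n \<in> L"
  by (simp add: Lenv_def)

text \<open>Definability over L with parameters. Formula and parameters stay under existential
  quantifiers, so the closure rules below compose without any formula being written down.\<close>

definition D :: "((nat \<Rightarrow> 'v::zfc_universe) \<Rightarrow> bool) \<Rightarrow> bool" where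
  "D F \<longleftrightarrow> (\<exists>p e. Lenv e \<and> (\<forall>s. Lenv s \<longrightarrow> (F s \<longleftrightarrow> sat L (mix s e) p)))"

text \<open>Slot 0 holds the value of the term in the definition of its graph, and the arguments
  move up by one slot.\<close>

definition DT :: "((nat \<Rightarrow> 'v::zfc_universe) \<Rightarrow> 'v) \<Rightarrow> bool" where
  "DT t \<longleftrightarrow> (\<forall>s. Lenv s \<longrightarrow> t s \<in> L) \<and> D (\<lambda>s. s 0 = t (\<lambda>n. s (Suc n)))"

primrec ren :: "(nat \<Rightarrow> nat) \<Rightarrow> fm \<Rightarrow> fm" where
  "ren f (Mem i j) = Mem (f i) (f j)"
| "ren f (Eq i j) = Eq (f i) (f j)"
| "ren f (Neg p) = Neg (ren f p)"
| "ren f (Conj p q) = Conj (ren f p) (ren f q)"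
| "ren f (Exi i p) = Exi (f i) (ren f p)"

text \<open>Bound variables are renamed together with free ones; injectivity excludes
  capture.\<close>

lemma sat_ren: "inj f \<Longrightarrow> sat A s (ren f p) \<longleftrightarrow> sat A (\<lambda>n. s (f n)) p"
proof (induction p arbitrary: s)
  case (Exi i p)
  have "(\<lambda>n. (s(f i := a)) (f n)) = (\<lambda>n. s (f n))(i := a)" for a
    using Exi.prems by (auto simp: inj_eq)
  then show ?case using Exi by simp
qed simp_all

lemma D_cong: "(\<And>s. Lenv s \<Longrightarrow> F s \<longleftrightarrow> G s) \<Longrightarrow> D F \<longleftrightarrow> D G"
  by (simp add: D_def)

lemma D_var_mem: "D (\<lambda>s. s i \<in> elts (s j))"
  unfolding D_def by (rule exI[of _ "Mem (2*i) (2*j)"], rule exI[of _ "\<lambda>_. zero"]) (simp add: Lenv_def)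

lemma D_var_eq: "D (\<lambda>s. s i = s j)"
  unfolding D_def by (rule exI[of _ "Eq (2*i) (2*j)"], rule exI[of _ "\<lambda>_. zero"]) (simp add: Lenv_def)

lemma D_var_const: "a \<in> L \<Longrightarrow> D (\<lambda>s. s i = a)"
  unfolding D_def by (rule exI[of _ "Eq (2*i) (Suc (2*0))"], rule exI[of _ "\<lambda>_. a"]) (unfold sat.simps mix_simps, simp add: Lenv_def)

lemma D_not: "D F \<Longrightarrow> D (\<lambda>s. \<not> F s)"
  unfolding D_def by (metis sat.simps(3))

lemma mix_ren:
  "(\<lambda>n. mix s e (mix (\<lambda>n. 2 * f n) (\<lambda>n. Suc (2 * g n)) n)) = mix (\<lambda>n. s (f n)) (\<lambda>n. e (g n))"
  by (rule ext) (simp add: mix_def[of "\<lambda>n. 2 * f n"] mix_def[of "\<lambda>n. s (f n)"])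

lemma inj_mix: "inj f \<Longrightarrow> inj g \<Longrightarrow> inj (mix (\<lambda>n. 2 * f n) (\<lambda>n. Suc (2 * g n)))"
proof (rule injI)
  fix m n assume inj: "inj f" "inj g"
    and eq: "mix (\<lambda>n. 2 * f n) (\<lambda>n. Suc (2 * g n)) m = mix (\<lambda>n. 2 * f n) (\<lambda>n. Suc (2 * g n)) n"
  have par: "even m \<longleftrightarrow> even n"
    using arg_cong[OF eq, of even] by (auto simp: mix_def split: if_splits)
  then have "m div 2 = n div 2" using eq inj by (auto simp: mix_def inj_eq split: if_splits)
  then show "m = n" using par by (metis even_two_times_div_two odd_two_times_div_two_succ)
qed

lemma D_ren:
  assumes "inj f" "D F"
  shows "D (\<lambda>s. F (\<lambda>n. s (f n)))"
proof -
  obtain p e where pe: "Lenv e" "\<And>s. Lenv s \<Longrightarrow> F s \<longleftrightarrow> sat L (mix s e) p"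
    using assms(2) unfolding D_def by blast
  let ?g = "mix (\<lambda>n. 2 * f n) (\<lambda>n. Suc (2 * n))"
  have "inj ?g" using inj_mix[OF assms(1), of "\<lambda>n. n"] by simp
  then have "F (\<lambda>n. s (f n)) \<longleftrightarrow> sat L (mix s e) (ren ?g p)" if "Lenv s" for s
    using pe(2)[OF Lenv_ren[OF that, of f]] mix_ren[of s e f "\<lambda>n. n"] by (simp add: sat_ren)
  then show ?thesis using pe(1) unfolding D_def by blast
qed

lemma D_conj:
  assumes "D F" "D G"
  shows "D (\<lambda>s. F s \<and> G s)"
proof -
  obtain p e where pe: "Lenv e" "\<And>s. Lenv s \<Longrightarrow> F s \<longleftrightarrow> sat L (mix s e) p"
    using assms(1) unfolding D_def by blast
  obtain q d where qd: "Lenv d" "\<And>s. Lenv s \<Longrightarrow> G s \<longleftrightarrow> sat L (mix s d) q"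
    using assms(2) unfolding D_def by blast
  \<comment> \<open>The parameters of both formulas are stored in one sequence
    \<open>mix e d\<close>: those of \<open>p\<close> move to its even places, those of
    \<open>q\<close> to its odd places.\<close>
  let ?f = "mix (\<lambda>n. 2 * n) (\<lambda>n. Suc (2 * (2 * n)))"
  let ?g = "mix (\<lambda>n. 2 * n) (\<lambda>n. Suc (2 * (Suc (2 * n))))"
  have inj: "inj ?f" "inj ?g"
    using inj_mix[of "\<lambda>n. n" "\<lambda>n. 2 * n", OF inj_on_id2 injI]
      inj_mix[of "\<lambda>n. n" "\<lambda>n. Suc (2 * n)", OF inj_on_id2 injI] by simp_all
  have "F s \<and> G s \<longleftrightarrow> sat L (mix s (mix e d)) (Conj (ren ?f p) (ren ?g q))" if "Lenv s" for s
    using pe(2)[OF that] qd(2)[OF that] mix_ren[of s "mix e d" "\<lambda>n. n" "\<lambda>n. 2 * n"]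
      mix_ren[of s "mix e d" "\<lambda>n. n" "\<lambda>n. Suc (2 * n)"]
    by (simp only: sat.simps sat_ren[OF inj(1)] sat_ren[OF inj(2)] mix_simps)
  then show ?thesis unfolding D_def using Lenv_mix[OF pe(1) qd(1)] by blast
qed

text \<open>Variables are de Bruijn indices: under a quantifier, slot 0 is the bound variable and the outer
  environment is shifted by one.\<close>

lemma D_ex:
  assumes "D (\<lambda>s. F (\<lambda>n. s (Suc n)) (s 0))"
  shows "D (\<lambda>s. \<exists>x\<in>L. F s x)"
proof -
  obtain p e where pe: "Lenv e" "\<And>s. Lenv s \<Longrightarrow> F (\<lambda>n. s (Suc n)) (s 0) \<longleftrightarrow> sat L (mix s e) p"
    using assms unfolding D_def by blast
  \<comment> \<open>The parameters are shifted by one place, which frees slot 1 for the bound variable.\<close>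
  let ?g = "mix (case_nat 1 (\<lambda>n. 2 * n)) (\<lambda>n. Suc (2 * (Suc n)))"
  have inj: "inj ?g"
  proof (rule injI)
    fix m n assume eq: "?g m = ?g n"
    have "even m \<longleftrightarrow> even n"
      using eq by (auto simp: mix_def split: if_splits nat.splits) presburger+
    moreover from this have "m div 2 = n div 2"
      using eq by (auto simp: mix_def split: if_splits nat.splits)
    ultimately show "m = n" by (metis even_two_times_div_two odd_two_times_div_two_succ)
  qed
  have "(\<exists>x\<in>L. F s x) \<longleftrightarrow> sat L (mix s (case_nat zero e)) (Exi 1 (ren ?g p))" if s: "Lenv s" for s
  proof -
    have "F s x \<longleftrightarrow> sat L ((mix s (case_nat zero e))(1 := x)) (ren ?g p)" if x: "x \<in> L" for x
    proof -
      have "(\<lambda>n. ((mix s (case_nat zero e))(1 := x)) (?g n)) = mix (case_nat x s) e"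
      proof
        fix n show "((mix s (case_nat zero e))(1 := x)) (?g n) = mix (case_nat x s) e n"
          unfolding mix_def[of "case_nat 1 _"] mix_def[of "case_nat x s"]
          by (simp split: nat.split) (auto simp: mix_def)
      qed
      then have "sat L ((mix s (case_nat zero e))(1 := x)) (ren ?g p) \<longleftrightarrow> sat L (mix (case_nat x s) e) p"
        unfolding sat_ren[OF inj] by (simp only:)
      then show ?thesis using pe(2)[OF Lenv_case[OF s x]] by (simp only: nat.case)
    qed
    then show ?thesis by (simp del: One_nat_def)
  qed
  moreover have "Lenv (case_nat zero e)" using pe by simp
  ultimately show ?thesis unfolding D_def by blast
qed

text \<open>Covers conditions on indices outside the object language, such as \<open>i = 0\<close>
  for a track number: they do not depend on the assignment and are true or false outright.\<close>

lemma D_triv: "D (\<lambda>s. Q)"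
  using D_var_eq[of 0 0] D_not[OF D_var_eq[of 0 0]] by (cases Q) simp_all

lemma D_disj: "D F \<Longrightarrow> D G \<Longrightarrow> D (\<lambda>s. F s \<or> G s)"
  using D_not[OF D_conj[OF D_not[of F] D_not[of G]]] by simp

lemma D_imp: "D F \<Longrightarrow> D G \<Longrightarrow> D (\<lambda>s. F s \<longrightarrow> G s)"
  unfolding imp_conv_disj by (intro D_disj D_not)

lemma D_iff: "D F \<Longrightarrow> D G \<Longrightarrow> D (\<lambda>s. F s \<longleftrightarrow> G s)"
  unfolding iff_conv_conj_imp by (intro D_conj D_imp)

lemma D_all:
  assumes "D (\<lambda>s. F (\<lambda>n. s (Suc n)) (s 0))"
  shows "D (\<lambda>s. \<forall>x\<in>L. F s x)"
  using D_not[OF D_ex[of "\<lambda>s x. \<not> F s x", OF D_not[OF assms]]] by simp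

section \<open>Definable terms\<close>

lemma DT_L: "DT t \<Longrightarrow> Lenv s \<Longrightarrow> t s \<in> L"
  by (simp add: DT_def)

lemma DT_var: "DT (\<lambda>s. s i)"
  unfolding DT_def using D_var_eq by simp

lemma DT_const: "a \<in> L \<Longrightarrow> DT (\<lambda>s. a)"
  unfolding DT_def using D_var_const by simp

lemma DT_ren:
  assumes "inj f" "DT t"
  shows "DT (\<lambda>s. t (\<lambda>n. s (f n)))"
proof -
  have "inj (case_nat 0 (\<lambda>n. Suc (f n)))"
    using assms(1) by (intro injI) (auto dest: injD split: nat.splits)
  from D_ren[OF this, of "\<lambda>s. s 0 = t (\<lambda>n. s (Suc n))"] show ?thesis
    using assms(2) unfolding DT_def by (simp add: Lenv_ren[of _ f])
qed

lemma DT_shift: "DT t \<Longrightarrow> DT (\<lambda>s. t (\<lambda>n. s (Suc n)))"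
  using DT_ren[of Suc t] by simp

text \<open>Substitution of a definable term: \<open>F s (t s)\<close> is rewritten with a
  quantifier over the value \<open>x = t s\<close>, which lies in L.\<close>

lemma D_let:
  assumes "DT t" "D (\<lambda>s. F (\<lambda>n. s (Suc n)) (s 0))"
  shows "D (\<lambda>s. F s (t s))"
proof -
  have "D (\<lambda>s. \<exists>x\<in>L. x = t s \<and> F s x)"
    by (rule D_ex, rule D_conj) (use assms in \<open>auto simp: DT_def\<close>)
  then show ?thesis
    by (rule D_cong[THEN iffD1, rotated]) (use DT_L[OF assms(1)] in auto)
qed

lemma D_mem: "DT t \<Longrightarrow> DT u \<Longrightarrow> D (\<lambda>s. t s \<in> elts (u s))"
  by (rule D_let[of t], assumption, rule D_let[of "\<lambda>s. u (\<lambda>n. s (Suc n))"], erule DT_shift, rule D_var_mem)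

lemma D_eq: "DT t \<Longrightarrow> DT u \<Longrightarrow> D (\<lambda>s. t s = u s)"
  by (rule D_let[of t], assumption, rule D_let[of "\<lambda>s. u (\<lambda>n. s (Suc n))"], erule DT_shift, rule D_var_eq)

lemma D_bex:
  assumes "DT t" "D (\<lambda>s. F (\<lambda>n. s (Suc n)) (s 0))"
  shows "D (\<lambda>s. \<exists>x\<in>elts (t s). F s x)"
proof -
  have "D (\<lambda>s. \<exists>x\<in>L. x \<in> elts (t s) \<and> F s x)"
    by (intro D_ex D_conj D_mem DT_var DT_shift assms)
  then show ?thesis
    by (rule D_cong[THEN iffD1, rotated]) (use DT_L[OF assms(1)] L_trans in blast)
qed

lemma D_ball:
  assumes "DT t" "D (\<lambda>s. F (\<lambda>n. s (Suc n)) (s 0))"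
  shows "D (\<lambda>s. \<forall>x\<in>elts (t s). F s x)"
  using D_not[OF D_bex[of t "\<lambda>s x. \<not> F s x", OF assms(1) D_not[OF assms(2)]]] by simp

text \<open>By reflection some level contains all parameters and evaluates the formula as L does;
  the subset is then definable over that level and enters L at the next one.\<close>

lemma separation_L:
  assumes "D F" "Lenv s" "a \<in> L"
  shows "vset {x \<in> elts a. F (case_nat x s)} \<in> L"
proof -
  obtain p e where pe: "Lenv e" "\<And>s. Lenv s \<Longrightarrow> F s \<longleftrightarrow> sat L (mix s e) p"
    using assms unfolding D_def by blast
  \<comment> \<open>\<open>k\<close> names the set \<open>a\<close> in the formula; it must differ
    from 0, the variable abstracted in \<open>Def\<close>, and from the free variables of
    \<open>p\<close>.\<close>
  obtain k where k: "k \<notin> insert 0 (free_vars p)"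
    using ex_new_if_finite[of "insert 0 (free_vars p)"] by auto
  define q where "q = Conj (Mem 0 k) p"
  define v where "v = (mix (case_nat zero s) e)(k := a)"
  have v: "Lenv v" using assms pe by (simp add: v_def Lenv_def mix_def split: nat.split)
  obtain R :: "'a \<Rightarrow> 'a" where R: "reflects R q" using reflection by blast
  obtain c where c: "Ord c" "range v \<subseteq> Lset c"
    using small_subset_Lset[of "range v"] v unfolding Lenv_def by auto
  obtain b where b: "closed_under R b" "c \<in> elts b" using ex_closed_under[of R c, OF reflectsD(1)[OF R] c(1)] by blast
  have ob: "Ord b" using b LimitD unfolding closed_under_def by blast
  have "Lset c \<subseteq> Lset b" using Lset_mono b(2) ob Ord_transD by blast
  then have vb: "v n \<in> Lset b" for n using c by blast
  have vk: "v k = a" by (simp add: v_def)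
  have eq: "sat (Lset b) (v(0 := x)) q \<longleftrightarrow> x \<in> elts a \<and> F' (case_nat x s)"
    if "x \<in> Lset b" and F': "\<And>s. Lenv s \<Longrightarrow> F' s \<longleftrightarrow> sat L (mix s e) p" for x F'
  proof -
    have xL: "x \<in> L" using that ob L_iff by blast
    have "sat (Lset b) (v(0 := x)) q \<longleftrightarrow> sat L (v(0 := x)) q"
      by (rule reflectsD(2)[OF R b(1)]) (use vb that in auto)
    also have "\<dots> \<longleftrightarrow> x \<in> elts a \<and> sat L (v(0 := x)) p"
      using k vk by (simp add: q_def)
    also have "sat L (v(0 := x)) p \<longleftrightarrow> sat L (mix (case_nat x s) e) p"
      by (rule sat_cong) (use k in \<open>auto simp: v_def mix_def split: nat.split\<close>)
    also have "\<dots> \<longleftrightarrow> F' (case_nat x s)" using F' xL assms by simp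
    finally show ?thesis .
  qed
  let ?X = "\<lambda>F'. {x \<in> elts a. F' (case_nat x s)}"
  have aL: "elts a \<subseteq> Lset b" using vb[of k] vk Lset_transD[OF ob] by auto
  have "vset (?X F') \<in> Def (Lset b)" if F': "\<And>s. Lenv s \<Longrightarrow> F' s \<longleftrightarrow> sat L (mix s e) p" for F'
    unfolding Def_def
    by (rule CollectI, rule exI[of _ q], rule exI[of _ v]) (use vb eq[OF _ F'] aL in auto)
  from this[OF pe(2)] show ?thesis using Def_Lset_L[OF ob] by blast
qed

text \<open>Combines replacement with separation: a small part of L lies in one level, and this
  level is itself an element of L to which \<open>separation_L\<close> applies.\<close>

lemma vset_in_L:
  assumes "D F" "Lenv s" "small X" "X \<subseteq> L" "\<And>x. x \<in> L \<Longrightarrow> x \<in> X \<longleftrightarrow> F (case_nat x s)"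
  shows "vset X \<in> L"
proof -
  obtain b where b: "Ord b" "X \<subseteq> Lset b" using small_subset_Lset assms by blast
  have "X = {x \<in> elts (vset (Lset b)). F (case_nat x s)}"
  proof -
    have "Lset b \<subseteq> L" using b(1) L_iff by blast
    then show ?thesis using b(2) assms(5) by auto
  qed
  then show ?thesis using separation_L[OF assms(1,2) Lset_in_L[OF b(1)]] by simp
qed

text \<open>The graph of the term is defined by extensionality: \<open>z = vset (X s)\<close> says
  that \<open>z\<close> and \<open>X s\<close> have the same members in L, and both are contained in
  L.\<close>

lemma DT_vset:
  assumes "\<And>s. Lenv s \<Longrightarrow> small (X s) \<and> X s \<subseteq> L"
    and "D (\<lambda>s. s 0 \<in> X (\<lambda>n. s (Suc n)))"
  shows "DT (\<lambda>s. vset (X s))"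
  unfolding DT_def
proof
  show "\<forall>s. Lenv s \<longrightarrow> vset (X s) \<in> L"
    using vset_in_L[OF assms(2)] assms(1) by simp
  \<comment> \<open>Under the quantifier slot 0 is the member \<open>z\<close> and slot 1 the value
    being described, so the arguments of \<open>X\<close> start at slot 2.\<close>
  have "inj (case_nat 0 (\<lambda>n. Suc (Suc n)))" by (auto simp: inj_def split: nat.splits)
  from D_ren[OF this assms(2)] have "D (\<lambda>s. \<forall>z\<in>L. z \<in> elts (s 0) \<longleftrightarrow> z \<in> X (\<lambda>n. s (Suc n)))"
    by (intro D_all D_iff D_mem DT_var) simp
  then show "D (\<lambda>s. s 0 = vset (X (\<lambda>n. s (Suc n))))"
  proof (rule D_cong[THEN iffD1, rotated])
    fix s :: "nat \<Rightarrow> 'a" assume s: "Lenv s"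
    let ?Y = "X (\<lambda>n. s (Suc n))"
    have Y: "small ?Y" "?Y \<subseteq> L" using assms(1) s by simp_all
    have "elts (s 0) \<subseteq> L" using L_trans[OF Lenv_at[OF s]] by blast
    then have "(\<forall>z\<in>L. (z \<in> elts (s 0)) = (z \<in> ?Y)) \<longleftrightarrow> elts (s 0) = ?Y" using Y(2) by blast
    also have "\<dots> \<longleftrightarrow> s 0 = vset ?Y" using elts_vset[OF Y(1)] elts_inject[of "s 0" "vset ?Y"] by (simp only:)
    finally show "(\<forall>z\<in>L. (z \<in> elts (s 0)) = (z \<in> ?Y)) \<longleftrightarrow> s 0 = vset ?Y" .
  qed
qed

lemma DT_set:
  assumes "\<And>s. Lenv s \<Longrightarrow> t s \<in> L" "D (\<lambda>s. s 0 \<in> elts (t (\<lambda>n. s (Suc n))))"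
  shows "DT t"
proof -
  have "DT (\<lambda>s. vset (elts (t s)))"
    by (rule DT_vset) (use assms L_trans in \<open>auto\<close>)
  then show ?thesis by simp
qed

lemma inj_shift1: "inj (case_nat 0 (\<lambda>n. Suc (Suc n)))"
  by (rule injI) (auto split: nat.splits)

lemma D_shift: "D F \<Longrightarrow> D (\<lambda>s. F (\<lambda>n. s (Suc n)))"
  using D_ren[of Suc F] by simp

lemma D_shift1: "D (\<lambda>s. F (\<lambda>n. s (Suc n)) (s 0)) \<Longrightarrow> D (\<lambda>s. F (\<lambda>n. s (Suc (Suc n))) (s 0))"
  using D_ren[OF inj_shift1, of "\<lambda>s. F (\<lambda>n. s (Suc n)) (s 0)"] by simp

lemma DT_shift1: "DT (\<lambda>s. g (\<lambda>n. s (Suc n)) (s 0)) \<Longrightarrow> DT (\<lambda>s. g (\<lambda>n. s (Suc (Suc n))) (s 0))"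
  using DT_ren[OF inj_shift1, of "\<lambda>s. g (\<lambda>n. s (Suc n)) (s 0)"] by simp

lemma DT_at:
  assumes "DT (\<lambda>s. g (\<lambda>n. s (Suc n)) (s 0))" "Lenv s" "x \<in> L"
  shows "g s x \<in> L"
  using DT_L[OF assms(1), of "case_nat x s"] assms(2,3) by simp

section \<open>Closure of definable terms under set operations\<close>

lemma DT_Collect:
  assumes "DT t" "D (\<lambda>s. F (\<lambda>n. s (Suc n)) (s 0))"
  shows "DT (\<lambda>s. vset {x \<in> elts (t s). F s x})"
proof (rule DT_vset)
  show "small {x \<in> elts (t s). F s x} \<and> {x \<in> elts (t s). F s x} \<subseteq> L" if "Lenv s" for s
    using L_trans[OF DT_L[OF assms(1) that]] by auto
  show "D (\<lambda>s. s 0 \<in> {x \<in> elts (t (\<lambda>n. s (Suc n))). F (\<lambda>n. s (Suc n)) x})"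
    unfolding mem_Collect_eq by (intro D_conj D_mem DT_var DT_shift assms)
qed

lemma DT_UN:
  assumes "DT t" "DT (\<lambda>s. g (\<lambda>n. s (Suc n)) (s 0))"
  shows "DT (\<lambda>s. vset (\<Union>x\<in>elts (t s). elts (g s x)))"
proof (rule DT_vset)
  fix s :: "nat \<Rightarrow> 'a" assume s: "Lenv s"
  have "g s x \<in> L" if "x \<in> elts (t s)" for x
    using DT_at[OF assms(2) s] L_trans[OF DT_L[OF assms(1) s] that] by blast
  then show "small (\<Union>x\<in>elts (t s). elts (g s x)) \<and> (\<Union>x\<in>elts (t s). elts (g s x)) \<subseteq> L"
    using L_trans by (auto intro!: small_UN)
next
  have "D (\<lambda>s. \<exists>x\<in>elts (t (\<lambda>n. s (Suc n))). s 0 \<in> elts (g (\<lambda>n. s (Suc n)) x))"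
    by (rule D_bex[OF DT_shift[OF assms(1)]], rule D_mem[OF DT_var DT_shift1[OF assms(2)]])
  then show "D (\<lambda>s. s 0 \<in> (\<Union>x\<in>elts (t (\<lambda>n. s (Suc n))). elts (g (\<lambda>n. s (Suc n)) x)))"
    by simp
qed

lemma DT_image:
  assumes "DT t" "DT (\<lambda>s. g (\<lambda>n. s (Suc n)) (s 0))"
  shows "DT (\<lambda>s. vset ((\<lambda>x. g s x) ` elts (t s)))"
proof (rule DT_vset)
  fix s :: "nat \<Rightarrow> 'a" assume s: "Lenv s"
  have "g s x \<in> L" if "x \<in> elts (t s)" for x
    using DT_at[OF assms(2) s] L_trans[OF DT_L[OF assms(1) s] that] by blast
  then show "small ((\<lambda>x. g s x) ` elts (t s)) \<and> (\<lambda>x. g s x) ` elts (t s) \<subseteq> L"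
    by (auto intro!: small_image)
next
  have "D (\<lambda>s. \<exists>x\<in>elts (t (\<lambda>n. s (Suc n))). s 0 = g (\<lambda>n. s (Suc n)) x)"
    by (rule D_bex[OF DT_shift[OF assms(1)]], rule D_eq[OF DT_var DT_shift1[OF assms(2)]])
  then show "D (\<lambda>s. s 0 \<in> (\<lambda>x. g (\<lambda>n. s (Suc n)) x) ` elts (t (\<lambda>n. s (Suc n))))"
    by (simp add: image_iff)
qed

lemma DT_upair:
  assumes "DT t" "DT u"
  shows "DT (\<lambda>s. upair (t s) (u s))"
  unfolding upair_def
proof (rule DT_vset)
  show "small {t s, u s} \<and> {t s, u s} \<subseteq> L" if "Lenv s" for s
    using DT_L[OF assms(1) that] DT_L[OF assms(2) that] by simp
  have "D (\<lambda>s. s 0 = t (\<lambda>n. s (Suc n)) \<or> s 0 = u (\<lambda>n. s (Suc n)))"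
    by (intro D_disj D_eq DT_var DT_shift assms)
  then show "D (\<lambda>s. s 0 \<in> {t (\<lambda>n. s (Suc n)), u (\<lambda>n. s (Suc n))})" by simp
qed

lemma DT_pair: "DT t \<Longrightarrow> DT u \<Longrightarrow> DT (\<lambda>s. pair (t s) (u s))"
  unfolding pair_def by (intro DT_upair)

lemma DT_insert:
  assumes "DT t" "DT u"
  shows "DT (\<lambda>s. vset (insert (t s) (elts (u s))))"
proof (rule DT_vset)
  show "small (insert (t s) (elts (u s))) \<and> insert (t s) (elts (u s)) \<subseteq> L" if "Lenv s" for s
    using DT_L[OF assms(1) that] L_trans[OF DT_L[OF assms(2) that]] by auto
  have "D (\<lambda>s. s 0 = t (\<lambda>n. s (Suc n)) \<or> s 0 \<in> elts (u (\<lambda>n. s (Suc n))))"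
    by (intro D_disj D_mem D_eq DT_var DT_shift assms)
  then show "D (\<lambda>s. s 0 \<in> insert (t (\<lambda>n. s (Suc n))) (elts (u (\<lambda>n. s (Suc n)))))" by simp
qed

lemma DT_succ: "DT t \<Longrightarrow> DT (\<lambda>s. succ (t s))"
  unfolding succ_def by (rule DT_insert)

lemma DT_union:
  assumes "DT t" "DT u"
  shows "DT (\<lambda>s. vset (elts (t s) \<union> elts (u s)))"
proof (rule DT_vset)
  show "small (elts (t s) \<union> elts (u s)) \<and> elts (t s) \<union> elts (u s) \<subseteq> L" if "Lenv s" for s
    using L_trans[OF DT_L[OF assms(1) that]] L_trans[OF DT_L[OF assms(2) that]] by auto
  have "D (\<lambda>s. s 0 \<in> elts (t (\<lambda>n. s (Suc n))) \<or> s 0 \<in> elts (u (\<lambda>n. s (Suc n))))"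
    by (intro D_disj D_mem D_eq DT_var DT_shift assms)
  then show "D (\<lambda>s. s 0 \<in> elts (t (\<lambda>n. s (Suc n))) \<union> elts (u (\<lambda>n. s (Suc n))))" by simp
qed

lemma DT_if:
  assumes "D F" "DT t" "DT u"
  shows "DT (\<lambda>s. if F s then t s else u s)"
proof (rule DT_set)
  show "(if F s then t s else u s) \<in> L" if "Lenv s" for s
    using DT_L[OF assms(2) that] DT_L[OF assms(3) that] by simp
  have "D (\<lambda>s. (F (\<lambda>n. s (Suc n)) \<and> s 0 \<in> elts (t (\<lambda>n. s (Suc n)))) \<or>
      (\<not> F (\<lambda>n. s (Suc n)) \<and> s 0 \<in> elts (u (\<lambda>n. s (Suc n)))))"
    by (intro D_disj D_conj D_mem DT_var D_not D_shift DT_shift assms)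
  then show "D (\<lambda>s. s 0 \<in> elts (if F (\<lambda>n. s (Suc n)) then t (\<lambda>n. s (Suc n)) else u (\<lambda>n. s (Suc n))))"
    by (rule D_cong[THEN iffD1, rotated]) simp
qed

lemma D_Ord: "DT t \<Longrightarrow> D (\<lambda>s. Ord (t s))"
  unfolding Ord_def transitive_def subset_eq
  by (intro D_conj D_ball D_mem DT_var DT_shift)

text \<open>The ordinals in a level form an ordinal \<open>c\<close>, since levels are transitive,
  and \<open>c\<close> is in L by separation. If the level contains all members of \<open>a\<close>,
  then \<open>a\<close> is at most \<open>c\<close>.\<close>

lemma Ord_in_L: "Ord a \<Longrightarrow> a \<in> L"
proof (induction a rule: eps_induct)
  case (1 a)
  have "elts a \<subseteq> L" using 1 Ord_in_Ord by blast
  then obtain b where b: "Ord b" "elts a \<subseteq> Lset b" using small_subset_Lset small_elts by blast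
  define c where "c = vset {x \<in> elts (vset (Lset b)). Ord x}"
  have "DT (\<lambda>s. vset {x \<in> elts (vset (Lset b)). Ord x})"
    by (intro DT_Collect DT_const Lset_in_L[OF b(1)] D_Ord DT_var)
  then have cL: "c \<in> L" unfolding c_def using DT_L[of _ "\<lambda>_. zero"] by (simp add: Lenv_def)
  have ec: "elts c = {x \<in> Lset b. Ord x}"
    unfolding c_def by (subst elts_vset[OF small_Collect]) simp
  have oc: "Ord c"
    by (rule OrdI) (use ec Ord_in_Ord Lset_transD[OF b(1)] in auto)
  have "elts a \<subseteq> elts c" using ec b 1(2) Ord_in_Ord by auto
  then have "a \<in> elts c \<or> a = c" using Ord_subset_iff 1(2) oc by blast
  then show ?case using cL L_trans by blast
qed

lemma DT_Ord: "Ord a \<Longrightarrow> DT (\<lambda>s. a)"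
  by (intro DT_const Ord_in_L)

section \<open>Recursion inside L\<close>

definition BigU :: "'v::zfc_universe \<Rightarrow> 'v" where
  "BigU a = vset (\<Union>x\<in>elts a. elts x)"

lemma elts_BigU [simp]: "elts (BigU a) = (\<Union>x\<in>elts a. elts x)"
  by (simp add: BigU_def)

lemma DT_BigU: "DT t \<Longrightarrow> DT (\<lambda>s. BigU (t s))"
  unfolding BigU_def by (rule DT_UN[of t "\<lambda>s x. x", OF _ DT_var])

lemma pair_in_BigU: "pair a y \<in> elts f \<Longrightarrow> y \<in> elts (BigU (BigU f))"
proof -
  assume *: "pair a y \<in> elts f"
  have "upair a y \<in> elts (pair a y)" by (simp add: pair_def)
  with * have "upair a y \<in> elts (BigU f)" by auto
  moreover have "y \<in> elts (upair a y)" by simp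
  ultimately show ?thesis unfolding elts_BigU[of "BigU f"] by blast
qed

text \<open>Application by separation from iterated unions: values lie two unions below
  \<open>f\<close> and their members three below. Avoiding a description operator makes this a
  definable term by the closure rules.\<close>

definition app :: "'v::zfc_universe \<Rightarrow> 'v \<Rightarrow> 'v" where
  "app f a = vset {x \<in> elts (BigU (BigU (BigU f))). \<exists>y\<in>elts (BigU (BigU f)). pair a y \<in> elts f \<and> x \<in> elts y}"

lemma app_eq:
  assumes "\<And>y. pair a y \<in> elts f \<longleftrightarrow> y = b"
  shows "app f a = b"
proof -
  have b: "b \<in> elts (BigU (BigU f))" using assms pair_in_BigU by blast
  then have "elts b \<subseteq> elts (BigU (BigU (BigU f)))" unfolding elts_BigU[of "BigU (BigU f)"] by blast
  then have "{x \<in> elts (BigU (BigU (BigU f))). \<exists>y\<in>elts (BigU (BigU f)). pair a y \<in> elts f \<and> x \<in> elts y} = elts b"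
    unfolding assms using b by blast
  then show ?thesis by (simp only: app_def vset_elts)
qed

lemma DT_app: "DT t \<Longrightarrow> DT u \<Longrightarrow> DT (\<lambda>s. app (t s) (u s))"
  unfolding app_def
  by (intro DT_Collect D_bex D_conj D_mem DT_BigU DT_pair DT_var DT_shift)

text \<open>Membership recursion. The earlier values reach \<open>G\<close> as a set of pairs rather
  than as an HOL function, since definability concerns maps from sets to sets.\<close>

function rec :: "('v::zfc_universe \<Rightarrow> 'v \<Rightarrow> 'v) \<Rightarrow> 'v \<Rightarrow> 'v" where
  "rec G x = G x (vset ((\<lambda>y. pair y (rec G y)) ` elts x))"
  by auto
termination
  by (relation "inv_image {(x, y). x \<in> elts y} snd") (simp_all add: foundation)

declare rec.simps [simp del]

definition graph :: "('v::zfc_universe \<Rightarrow> 'v \<Rightarrow> 'v) \<Rightarrow> 'v \<Rightarrow> 'v" where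
  "graph G x = vset ((\<lambda>y. pair y (rec G y)) ` elts x)"

lemma rec_graph: "rec G x = G x (graph G x)"
  unfolding graph_def by (rule rec.simps)

lemma elts_graph [simp]: "elts (graph G x) = (\<lambda>y. pair y (rec G y)) ` elts x"
  by (simp add: graph_def)

lemma app_graph [simp]: "y \<in> elts x \<Longrightarrow> app (graph G x) y = rec G y"
  by (rule app_eq) auto

definition restr :: "'v::zfc_universe \<Rightarrow> 'v \<Rightarrow> 'v" where
  "restr f a = vset {z \<in> elts f. \<exists>b\<in>elts a. \<exists>y\<in>elts (BigU (BigU f)). z = pair b y}"

lemma elts_restr: "z \<in> elts (restr f a) \<longleftrightarrow> z \<in> elts f \<and> (\<exists>b\<in>elts a. \<exists>y. z = pair b y)"
  unfolding restr_def using pair_in_BigU by auto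

lemma DT_restr: "DT t \<Longrightarrow> DT u \<Longrightarrow> DT (\<lambda>s. restr (t s) (u s))"
  unfolding restr_def
  by (intro DT_Collect D_bex D_eq DT_BigU DT_pair DT_var DT_shift)

text \<open>A first-order characterization of \<open>graph G r\<close> that does not mention \<open>rec\<close>.\<close>

definition attempt :: "('v::zfc_universe \<Rightarrow> 'v \<Rightarrow> 'v) \<Rightarrow> 'v \<Rightarrow> 'v \<Rightarrow> bool" where
  "attempt G r f \<longleftrightarrow> (\<forall>z\<in>elts f. \<exists>a\<in>elts r. z = pair a (G a (restr f a))) \<and>
     (\<forall>a\<in>elts r. pair a (G a (restr f a)) \<in> elts f)"

text \<open>Membership induction shows that \<open>f\<close> restricted to each
  \<open>a \<in> r\<close> is \<open>graph G a\<close>; transitivity of \<open>r\<close> ensures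
  that \<open>attempt\<close> governs \<open>f\<close> on all members of \<open>a\<close>.\<close>

lemma attempt_iff:
  assumes "Ord r"
  shows "attempt G r f \<longleftrightarrow> f = graph G r"
proof
  assume f: "attempt G r f"
  have *: "a \<in> elts r \<Longrightarrow> restr f a = graph G a" for a
  proof (induction a rule: eps_induct)
    case (1 a)
    have IH: "restr f b = graph G b" if "b \<in> elts a" for b
      using 1 that Ord_transD[OF assms] by blast
    have "z \<in> elts (restr f a) \<longleftrightarrow> z \<in> elts (graph G a)" for z
    proof
      assume "z \<in> elts (restr f a)"
      then obtain b y where "z \<in> elts f" "b \<in> elts a" "z = pair b y" unfolding elts_restr by blast
      moreover then obtain c where "z = pair c (G c (restr f c))" using f unfolding attempt_def by blast
      ultimately have "z = pair b (rec G b)" "b \<in> elts a" using IH by (auto simp: rec_graph[of G b])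
      then show "z \<in> elts (graph G a)" by simp
    next
      assume "z \<in> elts (graph G a)"
      then obtain b where b: "b \<in> elts a" "z = pair b (rec G b)" by auto
      then have "z = pair b (G b (restr f b))" using IH by (simp add: rec_graph[of G b])
      moreover have "b \<in> elts r" using 1 b Ord_transD[OF assms] by blast
      ultimately have "z \<in> elts f" using f unfolding attempt_def by blast
      then show "z \<in> elts (restr f a)" unfolding elts_restr using b by blast
    qed
    then show ?case by (auto simp flip: elts_inject)
  qed
  have "elts f = (\<lambda>a. pair a (G a (restr f a))) ` elts r" using f unfolding attempt_def by blast
  also have "\<dots> = elts (graph G r)" using * by (auto simp: rec_graph[of G])
  finally show "f = graph G r" by (simp only: elts_inject)
next
  assume f: "f = graph G r"
  have "restr f a = graph G a" if a: "a \<in> elts r" for a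
  proof -
    have "z \<in> elts (restr f a) \<longleftrightarrow> z \<in> elts (graph G a)" for z
      unfolding elts_restr f using Ord_transD[OF assms a] by auto
    then show ?thesis by (auto simp flip: elts_inject)
  qed
  then show "attempt G r f" unfolding attempt_def f by (auto simp: rec_graph[of G])
qed

text \<open>Phrased through substitution of arbitrary definable terms, which is the form in which
  introduction rules use it.\<close>

definition DT2 :: "('v::zfc_universe \<Rightarrow> 'v \<Rightarrow> 'v) \<Rightarrow> bool" where
  "DT2 G \<longleftrightarrow> (\<forall>t u. DT t \<longrightarrow> DT u \<longrightarrow> DT (\<lambda>s. G (t s) (u s)))"

lemma DT2D: "DT2 G \<Longrightarrow> DT t \<Longrightarrow> DT u \<Longrightarrow> DT (\<lambda>s. G (t s) (u s))"
  by (simp add: DT2_def)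

lemma DT2_L: "DT2 G \<Longrightarrow> a \<in> L \<Longrightarrow> b \<in> L \<Longrightarrow> G a b \<in> L"
  using DT_L[OF DT2D[of G, OF _ DT_const DT_const], of a b "\<lambda>_. zero"] by (simp add: Lenv_def)

lemma D_attempt: "DT2 G \<Longrightarrow> DT t \<Longrightarrow> DT u \<Longrightarrow> D (\<lambda>s. attempt G (t s) (u s))"
  unfolding attempt_def
  by (intro D_conj D_ball D_bex D_eq D_mem DT_pair DT2D[of G] DT_restr DT_var DT_shift)

text \<open>Induction on \<open>r\<close>: when the graphs for all \<open>a \<in> r\<close> are in
  L, the quantifier \<open>\<exists>f\<in>L. attempt G a f\<close> finds exactly these graphs, so
  the graph on \<open>r\<close> is a definable small part of L.\<close>

lemma graph_in_L:
  assumes G: "DT2 G" and "Ord r"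
  shows "graph G r \<in> L"
  using assms(2)
proof (induction r rule: eps_induct)
  case (1 r)
  have rL: "r \<in> L" using 1(2) Ord_in_L by blast
  have gL: "graph G a \<in> L" if "a \<in> elts r" for a using 1 that Ord_in_Ord by blast
  have aL: "a \<in> L" if "a \<in> elts r" for a using that rL L_trans by blast
  have recL: "rec G a \<in> L" if "a \<in> elts r" for a
    unfolding rec_graph using DT2_L[OF G aL gL] that by blast
  have pL: "pair a b \<in> L" if "a \<in> L" "b \<in> L" for a b :: 'a
    using DT_L[OF DT_pair[OF DT_const DT_const], OF that, of "\<lambda>_. zero"] by (simp add: Lenv_def)
  have "vset ((\<lambda>y. pair y (rec G y)) ` elts r) \<in> L"
  proof (rule vset_in_L)
    show "D (\<lambda>s. \<exists>a\<in>elts r. \<exists>f\<in>L. attempt G a f \<and> s 0 = pair a (G a f))"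
      by (intro D_bex D_ex D_conj D_eq D_attempt DT_pair DT2D[of G] G DT_var DT_const rL)
    show "Lenv (\<lambda>_. zero :: 'a)" by (simp add: Lenv_def)
    show "(\<lambda>y. pair y (rec G y)) ` elts r \<subseteq> L" using pL recL aL by blast
    show "x \<in> (\<lambda>y. pair y (rec G y)) ` elts r \<longleftrightarrow>
       (\<exists>a\<in>elts r. \<exists>f\<in>L. attempt G a f \<and> case_nat x (\<lambda>_. zero) 0 = pair a (G a f))" for x
      using gL attempt_iff[OF Ord_in_Ord[OF 1(2)], of _ G] by (auto simp: rec_graph[of G])
  qed simp
  then show ?case by (simp add: graph_def)
qed

text \<open>The value \<open>zero\<close> off the ordinals makes the term total; on ordinals,
  \<open>attempt\<close> singles out the graph, which is available in L as a witness.\<close>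

lemma DT_rec:
  assumes "DT2 G" "DT t"
  shows "DT (\<lambda>s. if Ord (t s) then rec G (t s) else zero)"
  unfolding DT_def
proof (intro conjI allI impI)
  fix s :: "nat \<Rightarrow> 'a" assume s: "Lenv s"
  show "(if Ord (t s) then rec G (t s) else zero) \<in> L"
    using DT2_L[OF assms(1) DT_L[OF assms(2) s] graph_in_L[OF assms(1), of "t s"]]
    by (simp add: rec_graph[of G])
next
  have "D (\<lambda>s. (Ord (t (\<lambda>n. s (Suc n))) \<and> (\<exists>f\<in>L. attempt G (t (\<lambda>n. s (Suc n))) f \<and> s 0 = G (t (\<lambda>n. s (Suc n))) f)) \<or>
    (\<not> Ord (t (\<lambda>n. s (Suc n))) \<and> s 0 = zero))"
    by (intro D_disj D_ex D_conj D_not D_eq D_Ord D_attempt DT2D[of G] DT_var DT_const zero_L DT_shift assms)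
  then show "D (\<lambda>s. s 0 = (if Ord (t (\<lambda>n. s (Suc n))) then rec G (t (\<lambda>n. s (Suc n))) else zero))"
  proof (rule D_cong[THEN iffD1, rotated])
    fix s :: "nat \<Rightarrow> 'a"
    show "(Ord (t (\<lambda>n. s (Suc n))) \<and> (\<exists>f\<in>L. attempt G (t (\<lambda>n. s (Suc n))) f \<and> s 0 = G (t (\<lambda>n. s (Suc n))) f)) \<or>
    (\<not> Ord (t (\<lambda>n. s (Suc n))) \<and> s 0 = zero) \<longleftrightarrow>
      s 0 = (if Ord (t (\<lambda>n. s (Suc n))) then rec G (t (\<lambda>n. s (Suc n))) else zero)"
      using graph_in_L[OF assms(1)] attempt_iff[of _ G] by (auto simp: rec_graph[of G])
  qed
qed

section \<open>Regular cardinals of L\<close>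

lemma Lenv_zero: "Lenv (\<lambda>_. zero)"
  by (simp add: Lenv_def)

lemma upair_L: "a \<in> L \<Longrightarrow> b \<in> L \<Longrightarrow> upair a b \<in> L"
  using DT_L[OF DT_upair[OF DT_const DT_const] Lenv_zero] .

lemma pair_L: "a \<in> L \<Longrightarrow> b \<in> L \<Longrightarrow> pair a b \<in> L"
  unfolding pair_def by (intro upair_L)

lemma upair_rel_iff: "a \<in> L \<Longrightarrow> b \<in> L \<Longrightarrow> z \<in> L \<Longrightarrow> upair_rel L a b z \<longleftrightarrow> z = upair a b"
  unfolding upair_rel_def elts_inject[symmetric, of z] elts_upair using L_trans by blast

lemma pair_rel_iff: "a \<in> L \<Longrightarrow> b \<in> L \<Longrightarrow> z \<in> L \<Longrightarrow> pair_rel L a b z \<longleftrightarrow> z = pair a b"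
  unfolding pair_rel_def pair_def using upair_rel_iff upair_L by metis

lemma app_rel_iff: "a \<in> L \<Longrightarrow> b \<in> L \<Longrightarrow> app_rel L f a b \<longleftrightarrow> pair a b \<in> elts f"
  unfolding app_rel_def using pair_rel_iff pair_L by metis

text \<open>Pairs are absolute for the transitive class L, so for a graph the relativized notions
  reduce to the HOL function \<open>g\<close>.\<close>

lemma function_rel_graph:
  assumes "a \<in> L" "b \<in> L" "\<And>x. x \<in> elts a \<Longrightarrow> g x \<in> elts b" "elts f = (\<lambda>x. pair x (g x)) ` elts a"
  shows "function_rel L f a b" "x \<in> elts a \<Longrightarrow> y \<in> L \<Longrightarrow> app_rel L f x y \<longleftrightarrow> y = g x"
proof -
  have L: "x \<in> L" "g x \<in> L" if "x \<in> elts a" for x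
    using assms that L_trans by blast+
  show *: "app_rel L f x y \<longleftrightarrow> y = g x" if "x \<in> elts a" "y \<in> L" for x y
    unfolding app_rel_iff[OF L(1)[OF that(1)] that(2)] assms(4) using that by auto
  show "function_rel L f a b"
    unfolding function_rel_def
  proof (intro conjI ballI)
    fix z assume "z \<in> L \<inter> elts f"
    then obtain x where x: "x \<in> elts a" "z = pair x (g x)" "z \<in> L" using assms(4) by auto
    then have "pair_rel L x (g x) z" using pair_rel_iff L by blast
    then show "\<exists>x\<in>L \<inter> elts a. \<exists>y\<in>L \<inter> elts b. pair_rel L x y z" using x L assms(3) by blast
  next
    fix x assume "x \<in> L \<inter> elts a"
    then show "\<exists>!y. y \<in> L \<and> app_rel L f x y" using * L by blast
  qed
qed

lemma omega_rel_omega: "omega_rel L (omega :: 'v::zfc_universe)"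
proof -
  have nL: "num n \<in> (L :: 'v set)" for n using Ord_in_L Ord_num by blast
  have ord: "ordinal_rel L (omega :: 'v)"
    unfolding ordinal_rel_def transitive_rel_def
    using LimitD(1)[OF Limit_omega] Ord_transD Ord_in_Ord by blast
  have "\<exists>b\<in>L. b \<in> elts (omega :: 'v)" using nL[of 0] by (auto simp del: num_simps)
  moreover have "\<forall>b\<in>L \<inter> elts (omega :: 'v). \<exists>c\<in>L \<inter> elts omega. b \<in> elts c"
  proof
    fix b assume "b \<in> L \<inter> elts (omega :: 'v)"
    then obtain n where "b = num n" by auto
    then have "b \<in> elts (num (Suc n))" by (simp del: num_simps)
    moreover have "num (Suc n) \<in> L \<inter> elts (omega :: 'v)" using nL by (simp del: num_simps)
    ultimately show "\<exists>c\<in>L \<inter> elts omega. b \<in> elts c" by blast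
  qed
  moreover have "\<not> limit_ordinal_rel L b" if b: "b \<in> elts (omega :: 'v)" for b :: 'v
  proof
    assume l: "limit_ordinal_rel L b"
    obtain n where n: "b = num n" using b by auto
    show False
    proof (cases n)
      case 0
      then show False using l n unfolding limit_ordinal_rel_def by auto
    next
      case (Suc m)
      then have "num m \<in> L \<inter> elts b" using n nL by (simp del: num_simps)
      then obtain c where c: "c \<in> elts b" "num m \<in> elts c" using l unfolding limit_ordinal_rel_def by blast
      then have "c \<in> elts (num m) \<or> c = num m" using n Suc by auto
      then show False using c mem_asym by auto
    qed
  qed
  ultimately show ?thesis using ord unfolding omega_rel_def limit_ordinal_rel_def by blast
qed

locale regular_in_L =
  fixes \<alpha> :: "'v::zfc_universe"
  assumes Ord_alpha: "Ord \<alpha>" and reg: "uncountable_regular_cardinal_rel L \<alpha>"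
begin

text \<open>Otherwise \<alpha> would be contained in \<omega>, and the identity on it, an element of
  L, would witness countability.\<close>

lemma omega_in_alpha: "omega \<in> elts \<alpha>"
proof (rule ccontr)
  assume "omega \<notin> elts \<alpha>"
  then have sub: "elts \<alpha> \<subseteq> elts (omega :: 'v)"
    using Ord_not_in[OF LimitD(1)[OF Limit_omega] Ord_alpha] by blast
  define f where "f = vset ((\<lambda>x. pair x x) ` elts \<alpha>)"
  have "DT (\<lambda>s. vset ((\<lambda>x. pair x x) ` elts \<alpha>))"
    by (intro DT_image DT_pair DT_var DT_Ord Ord_alpha)
  then have fL: "f \<in> L" unfolding f_def using DT_L Lenv_zero by blast
  have ef: "elts f = (\<lambda>x. pair x x) ` elts \<alpha>" by (simp add: f_def)
  have oL: "omega \<in> (L :: 'v set)" using Ord_in_L LimitD(1)[OF Limit_omega] by blast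
  have aL: "\<alpha> \<in> L" using Ord_in_L Ord_alpha by blast
  note * = function_rel_graph[of \<alpha> omega "\<lambda>x. x" f, OF aL oL _ ef]
  have "injection_rel L f \<alpha> omega"
    unfolding injection_rel_def
  proof (intro conjI ballI impI)
    show "function_rel L f \<alpha> omega" by (rule *(1)) (use sub in blast)
    fix a a' b assume "a \<in> L \<inter> elts \<alpha>" "a' \<in> L \<inter> elts \<alpha>" "b \<in> L" "app_rel L f a b \<and> app_rel L f a' b"
    then show "a = a'" using *(2) sub by blast
  qed
  then have "countable_rel L \<alpha>" unfolding countable_rel_def using oL omega_rel_omega fL by blast
  then show False using reg unfolding uncountable_regular_cardinal_rel_def by blast
qed

lemma num_in_alpha [simp]: "num n \<in> elts \<alpha>"
  using omega_in_alpha Ord_transD[OF Ord_alpha omega_in_alpha] by simp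

text \<open>The only form in which regularity is used: if the values of a definable \<open>g\<close>
  were unbounded, its graph would be an element of L and a cofinal map into \<alpha>.\<close>

lemma regular_bound:
  assumes g: "DT (\<lambda>s. g (s 0))" and b: "b \<in> elts \<alpha>" and gb: "\<And>x. x \<in> elts b \<Longrightarrow> g x \<in> elts \<alpha>"
  shows "\<exists>c\<in>elts \<alpha>. \<forall>x\<in>elts b. g x \<in> elts c"
proof (rule ccontr)
  assume no: "\<not> ?thesis"
  have ob: "Ord b" using b Ord_alpha Ord_in_Ord by blast
  have bL: "b \<in> L" using ob Ord_in_L by blast
  have aL: "\<alpha> \<in> L" using Ord_in_L Ord_alpha by blast
  define f where "f = vset ((\<lambda>x. pair x (g x)) ` elts b)"
  have "DT (\<lambda>s. vset ((\<lambda>x. pair x (g x)) ` elts b))"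
    by (intro DT_image DT_pair DT_var DT_const bL g)
  then have fL: "f \<in> L" unfolding f_def using DT_L Lenv_zero by blast
  have ef: "elts f = (\<lambda>x. pair x (g x)) ` elts b" by (simp add: f_def)
  note * = function_rel_graph[of b \<alpha> g f, OF bL aL gb ef]
  have "cofinal_map_rel L f b \<alpha>"
    unfolding cofinal_map_rel_def
  proof (intro conjI ballI)
    show "function_rel L f b \<alpha>" by (rule *(1))
    fix c assume c: "c \<in> L \<inter> elts \<alpha>"
    then obtain x where x: "x \<in> elts b" "g x \<notin> elts c" using no by blast
    have "Ord c" "Ord (g x)" using c gb[OF x(1)] Ord_alpha Ord_in_Ord by blast+
    then have "c = g x \<or> c \<in> elts (g x)" using x(2) Ord_linear by blast
    moreover have "x \<in> L" "g x \<in> L" using x bL aL gb L_trans by blast+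
    ultimately show "\<exists>d\<in>L \<inter> elts b. \<exists>e\<in>L. app_rel L f d e \<and> (c = e \<or> c \<in> elts e)"
      using *(2)[OF _ x(1)] x by blast
  qed
  then show False using reg fL b bL unfolding uncountable_regular_cardinal_rel_def regular_rel_def by blast
qed

lemma Limit_alpha: "Limit \<alpha>"
  unfolding Limit_def
proof (intro conjI ballI)
  show "Ord \<alpha>" by (rule Ord_alpha)
  show "\<alpha> \<noteq> zero" using omega_in_alpha by auto
  fix c assume c: "c \<in> elts \<alpha>"
  have oc: "Ord c" using c Ord_alpha Ord_in_Ord by blast
  \<comment> \<open>On the one-point domain \<open>num 1\<close> regularity says that
    \<open>c\<close> is a member of some \<open>d\<close> in \<alpha>, so \<alpha> is not a
    successor.\<close>
  obtain d where d: "d \<in> elts \<alpha>" "\<forall>x\<in>elts (num 1 :: 'v). c \<in> elts d"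
    using regular_bound[of "\<lambda>_. c" "num 1", OF DT_Ord[OF oc] num_in_alpha c] by blast
  have "c \<in> elts d" using d(2) by simp
  moreover have od: "Ord d" using d Ord_alpha Ord_in_Ord by blast
  ultimately have "succ c \<in> elts (succ d)" using Ord_succ_mem_succ by blast
  then have "succ c \<in> elts d \<or> succ c = d" by (auto simp del: elts_succ simp: elts_succ[of d])
  then show "succ c \<in> elts \<alpha>" using d Ord_transD[OF Ord_alpha] by blast
qed

end

section \<open>Runs of register machines\<close>

lemma Ord_induct_le [consumes 2, case_names zero succ Limit]:
  assumes "Ord t" "s \<in> elts (succ t)"
    and zero: "Q zero"
    and succ: "\<And>s. s \<in> elts t \<Longrightarrow> Ord s \<Longrightarrow> Q s \<Longrightarrow> Q (succ s)"
    and Limit: "\<And>s. s \<in> elts (succ t) \<Longrightarrow> Limit s \<Longrightarrow> (\<And>r. r \<in> elts s \<Longrightarrow> Q r) \<Longrightarrow> Q s"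
  shows "Q s"
  using assms(2)
proof (induction s rule: eps_induct)
  case (1 s)
  have ot: "Ord (succ t)" using assms(1) by simp
  have os: "Ord s" using ot 1(2) Ord_in_Ord by blast
  have IH: "Q r" if "r \<in> elts s" for r using 1(1)[OF that] Ord_transD[OF ot 1(2) that] by blast
  from os show ?case
  proof (cases rule: Ord_cases)
    case 1
    then show ?thesis using zero by simp
  next
    case (2 b)
    have "b \<in> elts t"
      using \<open>s \<in> elts (succ t)\<close> 2 Ord_transD[OF assms(1), of s b] by auto
    then show ?thesis using 2 IH succ by simp
  next
    case 3
    then show ?thesis using Limit[OF \<open>s \<in> elts (succ t)\<close>] IH by blast
  qed
qed

text \<open>Track 0 is the active line, track \<open>i + 1\<close> is register \<open>i\<close>.\<close>

definition track :: "'v::zfc_universe config \<Rightarrow> nat \<Rightarrow> 'v" where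
  "track C i = (case i of 0 \<Rightarrow> num (active_line C) | Suc j \<Rightarrow> regs C j)"

lemma track_simps [simp]: "track C 0 = num (active_line C)" "track C (Suc j) = regs C j"
  by (simp_all add: track_def)

lemma config_eqI: "(\<And>i. track C i = track C' i) \<Longrightarrow> C = C'"
proof -
  assume *: "\<And>i. track C i = track C' i"
  have "active_line C = active_line C'" using *[of 0] by simp
  moreover have "regs C = regs C'" using *[of "Suc _"] by auto
  ultimately show ?thesis by (simp add: prod_eq_iff)
qed

text \<open>\<open>exec\<close> rewritten on tracks. The line \<open>l\<close> is a fixed natural
  number here, so for each command the new track is a definable term in the old ones.\<close>

fun cmd_track :: "'v::zfc_universe \<Rightarrow> command \<Rightarrow> nat \<Rightarrow> (nat \<Rightarrow> 'v) \<Rightarrow> nat \<Rightarrow> 'v" where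
  "cmd_track x (Inc j) l h i =
     (if i = 0 then num (Suc l) else if i = Suc j then succ (h (Suc j)) else h i)"
| "cmd_track x (Copy j k) l h i =
     (if i = 0 then num (Suc l) else if i = Suc k then h (Suc j) else h i)"
| "cmd_track x (JumpEq j k m) l h i =
     (if i = 0 then (if h (Suc j) = h (Suc k) then num m else num (Suc l)) else h i)"
| "cmd_track x (Oracle j) l h i =
     (if i = 0 then num (Suc l) else if i = Suc j then (if h (Suc j) \<in> elts x then succ zero else zero) else h i)"

lemma track_exec: "track (exec x cmd C) i = cmd_track x cmd (active_line C) (track C) i"
  by (cases C; cases cmd; cases i) (auto simp del: num_simps)

text \<open>Indexing \<open>P\<close> by track 0 is replaced by a finite case distinction over the
  lines below the last argument, each compared with a numeral. With \<open>length P\<close> there,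
  no match means that the machine has halted and keeps its tracks.\<close>

primrec prog_track :: "'v::zfc_universe \<Rightarrow> program \<Rightarrow> (nat \<Rightarrow> 'v) \<Rightarrow> nat \<Rightarrow> nat \<Rightarrow> 'v" where
  "prog_track x P h i 0 = h i"
| "prog_track x P h i (Suc l) = (if h 0 = num l then cmd_track x (P ! l) l h i else prog_track x P h i l)"

lemma prog_track_eq:
  "prog_track x P (track C) i n =
     (if active_line C < n then cmd_track x (P ! active_line C) (active_line C) (track C) i else track C i)"
  by (induction n) (auto simp: less_Suc_eq)

lemma track_step: "track (step P x C) i = prog_track x P (track C) i (length P)"
  unfolding prog_track_eq step_def halted_def by (simp add: track_exec not_less[symmetric])

fun cmd_regs :: "command \<Rightarrow> nat set" where
  "cmd_regs (Inc j) = {j}"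
| "cmd_regs (Copy j k) = {j, k}"
| "cmd_regs (JumpEq j k m) = {j, k}"
| "cmd_regs (Oracle j) = {j}"

fun jump_target :: "command \<Rightarrow> nat" where
  "jump_target (JumpEq j k m) = m"
| "jump_target _ = 0"

lemma ex_reg_bound: "\<exists>N. \<forall>cmd\<in>set P. \<forall>j\<in>cmd_regs cmd. j < N"
proof -
  have "finite (cmd_regs cmd)" for cmd by (cases cmd) auto
  then have "finite (\<Union>cmd\<in>set P. cmd_regs cmd)" by blast
  then show ?thesis unfolding finite_nat_set_iff_bounded by simp
qed

text \<open>Any line reached is at most the length of the program or a jump target, and the sum
  dominates each target. A bound common to all times makes the supremum of line indices in
  \<open>limit_config\<close> genuine.\<close>

definition line_bound :: "program \<Rightarrow> nat" where
  "line_bound P = length P + sum_list (map jump_target P)"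

lemma step_line: "active_line C \<le> line_bound P \<Longrightarrow> active_line (step P x C) \<le> line_bound P"
proof (cases "halted P C")
  case False
  then have l: "active_line C < length P" by (simp add: halted_def)
  then have "jump_target (P ! active_line C) \<le> sum_list (map jump_target P)"
    by (intro member_le_sum_list) simp_all
  then have "active_line (exec x (P ! active_line C) C) \<le> line_bound P"
    using l unfolding line_bound_def by (cases C; cases "P ! active_line C") auto
  then show ?thesis using False by (simp add: step_def)
qed (simp add: step_def)

lemma step_unmentioned:
  assumes "\<forall>cmd\<in>set P. \<forall>j\<in>cmd_regs cmd. j < N" "N \<le> j"
  shows "regs (step P x C) j = regs C j"
proof (cases "halted P C")
  case False
  then have "P ! active_line C \<in> set P" by (simp add: halted_def)
  then have "j \<notin> cmd_regs (P ! active_line C)" using assms by fastforce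
  then show ?thesis using False by (cases C; cases "P ! active_line C") (auto simp: step_def)
qed (simp add: step_def)

lemma diff_ne: "s \<in> elts m \<Longrightarrow> s \<in> elts m - elts s"
  by simp

lemma limit_regs_const:
  assumes "Limit m" "\<And>r. r \<in> elts m \<Longrightarrow> regs (c r) j = a"
  shows "regs (limit_config m c) j = a"
proof -
  have "(\<Inter>\<rho>\<in>elts m - elts \<sigma>. elts (regs (c \<rho>) j)) = elts a" if "\<sigma> \<in> elts m" for \<sigma>
    using assms(2) diff_ne[OF that] by auto
  then have "(\<Union>\<sigma>\<in>elts m. \<Inter>\<rho>\<in>elts m - elts \<sigma>. elts (regs (c \<rho>) j)) = elts a"
    using LimitD(3)[OF assms(1)] by auto
  then show ?thesis by (simp add: limit_config_def)
qed

text \<open>Infima of nonempty sets of naturals are attained, and \<open>B\<close> makes the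
  supremum over \<open>nat\<close> genuine; a tail is nonempty because it contains its own starting
  point.\<close>

lemma limit_line_less:
  assumes "Limit m" "\<And>r. r \<in> elts m \<Longrightarrow> active_line (c r) \<le> B"
  shows "k < active_line (limit_config m c) \<longleftrightarrow> (\<exists>s\<in>elts m. \<forall>r\<in>elts m - elts s. k < active_line (c r))"
proof -
  let ?I = "\<lambda>s. INF r\<in>elts m - elts s. active_line (c r)"
  have I: "k < ?I s \<longleftrightarrow> (\<forall>r\<in>elts m - elts s. k < active_line (c r))" if "s \<in> elts m" for s k
  proof -
    let ?A = "(\<lambda>r. active_line (c r)) ` (elts m - elts s)"
    have "?A \<noteq> {}" using diff_ne[OF that] by blast
    then have "Inf ?A \<in> ?A" by (rule Inf_nat_def1)
    moreover have "Inf ?A \<le> a" if "a \<in> ?A" for a using that by (intro cInf_lower) auto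
    ultimately show ?thesis by (metis (no_types, lifting) image_iff order_less_le_trans)
  qed
  have "?I s \<le> B" if "s \<in> elts m" for s
    using I[OF that, of B] assms(2) diff_ne[OF that] by (meson DiffD1 not_le)
  then have "bdd_above (?I ` elts m)" by (intro bdd_aboveI[of _ B]) blast
  then have "k < (SUP s\<in>elts m. ?I s) \<longleftrightarrow> (\<exists>s\<in>elts m. k < ?I s)"
    by (rule less_cSUP_iff[rotated]) (use LimitD(3)[OF assms(1)] in auto)
  then show ?thesis using I by (simp add: limit_config_def)
qed

lemma limit_line_bound:
  assumes "Limit m" "\<And>r. r \<in> elts m \<Longrightarrow> active_line (c r) \<le> B"
  shows "active_line (limit_config m c) \<le> B"
  using limit_line_less[of m c B B, OF assms] assms(2) diff_ne by (meson DiffD1 not_le)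

text \<open>The inferior limit of \<open>limit_config\<close>, carved out of a union by bounded
  quantifiers so that it is visibly a definable term.\<close>

definition liminf :: "'v::zfc_universe \<Rightarrow> ('v \<Rightarrow> 'v) \<Rightarrow> 'v" where
  "liminf m T = vset {z \<in> elts (vset (\<Union>r\<in>elts m. elts (T r))). \<exists>s\<in>elts m. \<forall>r\<in>elts m. r \<notin> elts s \<longrightarrow> z \<in> elts (T r)}"

lemma mem_liminf:
  "z \<in> elts (liminf m T) \<longleftrightarrow> (\<exists>s\<in>elts m. \<forall>r\<in>elts m. r \<notin> elts s \<longrightarrow> z \<in> elts (T r))"
proof -
  have sm: "small (\<Union>r\<in>elts m. elts (T r))" by (rule small_UN) simp_all
  have "elts (liminf m T) = {z \<in> \<Union>r\<in>elts m. elts (T r). \<exists>s\<in>elts m. \<forall>r\<in>elts m. r \<notin> elts s \<longrightarrow> z \<in> elts (T r)}"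
    unfolding liminf_def elts_vset[OF sm] by (rule elts_vset, rule small_subset[OF sm]) blast
  \<comment> \<open>As \<open>s \<notin> elts s\<close>, the time \<open>s\<close> belongs to its
    own tail, so membership in the bounding union is automatic.\<close>
  then show ?thesis using mem_irrefl by blast
qed

lemma liminf_eq: "liminf m T = vset (\<Union>s\<in>elts m. \<Inter>r\<in>elts m - elts s. elts (T r))"
proof -
  have "(\<Union>s\<in>elts m. \<Inter>r\<in>elts m - elts s. elts (T r)) = elts (liminf m T)"
    unfolding set_eq_iff mem_liminf UN_iff INT_iff Ball_def Diff_iff imp_conjL by simp
  then show ?thesis by simp
qed

text \<open>On numerals the order is membership, so the supremum of infima in \<open>nat\<close>
  agrees with the set-theoretic inferior limit, and line and registers obey one limit rule.\<close>

lemma track_limit: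
  assumes "Limit m" "\<And>r. r \<in> elts m \<Longrightarrow> active_line (c r) \<le> B"
  shows "track (limit_config m c) i = liminf m (\<lambda>r. track (c r) i)"
proof (cases i)
  case (Suc j)
  then show ?thesis by (simp add: limit_config_def liminf_eq)
next
  case 0
  have "z \<in> elts (num (active_line (limit_config m c))) \<longleftrightarrow> z \<in> elts (liminf m (\<lambda>r. num (active_line (c r))))" for z
  proof
    assume "z \<in> elts (num (active_line (limit_config m c)))"
    then obtain k where "z = num k" "k < active_line (limit_config m c)" by (auto simp: elts_num)
    then show "z \<in> elts (liminf m (\<lambda>r. num (active_line (c r))))"
      unfolding mem_liminf using limit_line_less[of m c B k, OF assms] by auto
  next
    assume z: "z \<in> elts (liminf m (\<lambda>r. num (active_line (c r))))"
    then obtain s where s: "s \<in> elts m" "\<forall>r\<in>elts m. r \<notin> elts s \<longrightarrow> z \<in> elts (num (active_line (c r)))"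
      unfolding mem_liminf by blast
    then have "z \<in> elts (num (active_line (c s)))" by simp
    then obtain k where k: "z = num k" by (auto simp: elts_num)
    have "\<exists>s\<in>elts m. \<forall>r\<in>elts m - elts s. k < active_line (c r)" using s k by auto
    then have "k < active_line (limit_config m c)"
      using limit_line_less[of m c B k, OF assms] by simp
    then show "z \<in> elts (num (active_line (limit_config m c)))" using k by simp
  qed
  then show ?thesis using 0 by (auto simp flip: elts_inject)
qed

lemma liminf_cong: "(\<And>r. r \<in> elts m \<Longrightarrow> T r = U r) \<Longrightarrow> liminf m T = liminf m U"
  by (auto simp: mem_liminf simp flip: elts_inject)

section \<open>Invariants of a fixed run\<close>

locale run =
  fixes P :: program and x :: "'v::zfc_universe" and \<xi>s :: "'v list" and \<tau> :: 'v and c :: "'v \<Rightarrow> 'v config"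
  assumes Ord_tau: "Ord \<tau>" and comp: "computation P x \<xi>s \<tau> c"
begin

lemma c_zero: "c zero = start_config \<xi>s"
  and c_succ: "s \<in> elts \<tau> \<Longrightarrow> c (succ s) = step P x (c s)"
  and c_Limit: "s \<in> elts (succ \<tau>) \<Longrightarrow> Limit s \<Longrightarrow> c s = limit_config s c"
  using comp unfolding computation_def by blast+

lemma time_trans: "s \<in> elts (succ \<tau>) \<Longrightarrow> r \<in> elts s \<Longrightarrow> r \<in> elts (succ \<tau>)"
  using Ord_transD[of "succ \<tau>"] Ord_tau by (simp del: elts_succ)

lemma line_le:
  assumes "s \<in> elts (succ \<tau>)"
  shows "active_line (c s) \<le> line_bound P"
  using Ord_tau assms
proof (induction rule: Ord_induct_le)
  case zero
  then show ?case by (simp add: c_zero start_config_def)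
next
  case (succ s)
  then show ?case using step_line by (simp add: c_succ)
next
  case (Limit s)
  then show ?case using limit_line_bound[of s c] by (simp add: c_Limit del: elts_succ)
qed

lemma c_track_Limit: "s \<in> elts (succ \<tau>) \<Longrightarrow> Limit s \<Longrightarrow> track (c s) i = liminf s (\<lambda>r. track (c r) i)"
  using track_limit[of s c] line_le time_trans by (subst c_Limit) blast+

lemma unmentioned:
  assumes "\<forall>cmd\<in>set P. \<forall>j\<in>cmd_regs cmd. j < N" "N \<le> j" "s \<in> elts (succ \<tau>)"
  shows "regs (c s) j = regs (start_config \<xi>s) j"
  using Ord_tau assms(3)
proof (induction rule: Ord_induct_le)
  case zero
  then show ?case by (simp add: c_zero)
next
  case (succ s)
  then show ?case using step_unmentioned[OF assms(1,2), of x "c s"] by (simp add: c_succ)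
next
  case (Limit s)
  then show ?case using limit_regs_const[of s c] by (simp add: c_Limit del: elts_succ)
qed

end

text \<open>A configuration has infinitely many registers and is not a set; the code keeps the first
  \<open>M\<close> tracks, which suffice as a program mentions finitely many registers.\<close>

definition tup :: "nat \<Rightarrow> (nat \<Rightarrow> 'v::zfc_universe) \<Rightarrow> 'v" where
  "tup M h = vset ((\<lambda>i. pair (num i) (h i)) ` {..<M})"

lemma elts_tup [simp]: "elts (tup M h) = (\<lambda>i. pair (num i) (h i)) ` {..<M}"
  unfolding tup_def by (rule elts_vset, rule small_finite) simp

lemma app_tup [simp]: "i < M \<Longrightarrow> app (tup M h) (num i) = h i"
  by (rule app_eq) auto

lemma DT_num: "DT (\<lambda>s. num n)"
  by (rule DT_Ord) simp

lemma DT_tup: "(\<And>i. DT (\<lambda>s. h s i)) \<Longrightarrow> DT (\<lambda>s. tup M (h s))"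
proof (induction M)
  case 0
  have "tup 0 (h s) = zero" for s by (simp add: zero_iff)
  then show ?case using DT_num[of 0] by simp
next
  case (Suc M)
  have "tup (Suc M) (h s) = vset (insert (pair (num M) (h s M)) (elts (tup M (h s))))" for s
    unfolding elts_tup tup_def[of "Suc M"] lessThan_Suc image_insert ..
  then show ?case using Suc DT_insert[OF DT_pair[OF DT_num Suc.prems] Suc.IH] by simp
qed

lemma DT_cmd_track:
  assumes "x \<in> L" "\<And>i. DT (\<lambda>s. h s i)"
  shows "DT (\<lambda>s. cmd_track x cmd l (h s) i)"
proof (cases cmd)
  case (Inc j)
  then show ?thesis by (simp only: cmd_track.simps) (intro DT_if D_triv DT_succ DT_num assms)
next
  case (Copy j k)
  then show ?thesis by (simp only: cmd_track.simps) (intro DT_if D_triv DT_num assms)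
next
  case (JumpEq j k m)
  then show ?thesis by (simp only: cmd_track.simps) (intro DT_if D_triv D_eq DT_num assms)
next
  case (Oracle j)
  have "DT (\<lambda>s. zero :: 'a)" "DT (\<lambda>s. succ zero :: 'a)" using DT_num[of 0] DT_num[of 1] by simp_all
  with Oracle show ?thesis
    by (simp only: cmd_track.simps) (intro DT_if D_triv D_mem DT_num DT_const[OF assms(1)] assms(2))
qed

lemma DT_prog_track:
  assumes "x \<in> L" "\<And>i. DT (\<lambda>s. h s i)"
  shows "DT (\<lambda>s. prog_track x P (h s) i n)"
proof (induction n)
  case (Suc n)
  then show ?case unfolding prog_track.simps
    by (intro DT_if D_eq DT_cmd_track assms DT_num)
qed (simp add: assms)

lemma cmd_track_cong:
  assumes "\<And>j. j \<le> N \<Longrightarrow> h j = h' j" "\<forall>j\<in>cmd_regs cmd. j < N" "i \<le> N"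
  shows "cmd_track x cmd l h i = cmd_track x cmd l h' i"
  using assms by (cases cmd) (auto simp: Suc_le_eq)

text \<open>A coded configuration is correct only on tracks up to \<open>N\<close>. Register
  \<open>j\<close> sits on track \<open>j + 1\<close>, so registers below \<open>N\<close> stay
  within this range.\<close>

lemma prog_track_cong:
  assumes "\<And>j. j \<le> N \<Longrightarrow> h j = h' j" "\<forall>cmd\<in>set P. \<forall>j\<in>cmd_regs cmd. j < N" "i \<le> N" "n \<le> length P"
  shows "prog_track x P h i n = prog_track x P h' i n"
  using assms(4)
proof (induction n)
  case (Suc n)
  then have "P ! n \<in> set P" by simp
  then have "cmd_track x (P ! n) n h i = cmd_track x (P ! n) n h' i"
    using cmd_track_cong[of N h h' "P ! n", OF assms(1)] assms(2,3) by blast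
  then show ?case using Suc assms(1)[of 0] by simp
qed (use assms in simp)

lemma DT_liminf:
  assumes "DT t" "DT (\<lambda>s. g (\<lambda>n. s (Suc n)) (s 0))"
  shows "DT (\<lambda>s. liminf (t s) (g s))"
  unfolding liminf_def
proof (rule DT_Collect[OF DT_UN[OF assms]])
  \<comment> \<open>Three binders (the member, the start of the tail, the time) come before the
    arguments of \<open>g\<close>, and the time is the innermost one.\<close>
  have g3: "DT (\<lambda>s. g (\<lambda>n. s (Suc (Suc (Suc n)))) (s 0))"
    using DT_ren[of "case_nat 0 (\<lambda>n. Suc (Suc (Suc n)))", OF _ assms(2)]
    by (auto simp: inj_def split: nat.splits)
  show "D (\<lambda>s. \<exists>s'\<in>elts (t (\<lambda>n. s (Suc n))). \<forall>r\<in>elts (t (\<lambda>n. s (Suc n))). r \<notin> elts s' \<longrightarrow> s 0 \<in> elts (g (\<lambda>n. s (Suc n)) r))"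
    by (rule D_bex[OF DT_shift[OF assms(1)]], rule D_ball[OF DT_shift[OF DT_shift[OF assms(1)]]])
      (intro D_imp D_not D_mem DT_var g3)
qed

text \<open>At argument \<open>\<sigma>\<close>, \<open>f\<close> is the graph of the coded run
  below \<open>\<sigma>\<close>.\<close>

definition run_step :: "program \<Rightarrow> 'v::zfc_universe \<Rightarrow> (nat \<Rightarrow> 'v) \<Rightarrow> nat \<Rightarrow> 'v \<Rightarrow> 'v \<Rightarrow> 'v" where
  "run_step P x h M \<sigma> f =
     (if \<sigma> = zero then tup M h
      else if \<exists>\<rho>\<in>elts \<sigma>. \<sigma> = succ \<rho>
        then tup M (\<lambda>i. prog_track x P (\<lambda>j. app (app f (BigU \<sigma>)) (num j)) i (length P))
      else tup M (\<lambda>i. liminf \<sigma> (\<lambda>\<rho>. app (app f \<rho>) (num i))))"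

lemma DT2_run_step:
  assumes "x \<in> L" "\<And>i. h i \<in> L"
  shows "DT2 (run_step P x h M)"
  unfolding DT2_def run_step_def
  by (intro allI impI DT_if DT_tup D_eq D_bex DT_prog_track DT_liminf DT_app DT_BigU DT_succ DT_var DT_num
      DT_const assms zero_L DT_shift)

text \<open>Justifies \<open>BigU \<sigma>\<close> as the predecessor in the successor case of
  \<open>run_step\<close>.\<close>

lemma BigU_succ: "Ord s \<Longrightarrow> BigU (succ s) = s"
  by (auto simp flip: elts_inject dest: Ord_transD)

context run
begin

lemma coded_run:
  assumes N: "\<forall>cmd\<in>set P. \<forall>j\<in>cmd_regs cmd. j < N" and i: "i \<le> N" and s: "s \<in> elts (succ \<tau>)"
  shows "app (rec (run_step P x (track (start_config \<xi>s)) (Suc N)) s) (num i) = track (c s) i"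
    (is "app (rec ?G s) _ = _")
  using Ord_tau s i
proof (induction arbitrary: i rule: Ord_induct_le)
  case zero
  then show ?case by (simp add: rec_graph[of ?G zero] run_step_def[of _ _ _ _ zero] c_zero)
next
  case (succ s)
  have "rec ?G (succ s) = tup (Suc N) (\<lambda>i. prog_track x P (\<lambda>j. app (rec ?G s) (num j)) i (length P))"
    unfolding rec_graph[of ?G "succ s"] run_step_def[of _ _ _ _ "succ s"] BigU_succ[OF succ(2)]
    by simp
  then have "app (rec ?G (succ s)) (num i) = prog_track x P (\<lambda>j. app (rec ?G s) (num j)) i (length P)"
    using succ.prems by simp
  also have "\<dots> = prog_track x P (track (c s)) i (length P)"
    by (rule prog_track_cong[OF _ N succ.prems]) (use succ.IH in auto)
  also have "\<dots> = track (c (succ s)) i" using succ(1) by (simp add: c_succ track_step)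
  finally show ?case .
next
  case (Limit s)
  have ns: "\<not> (\<exists>r\<in>elts s. s = succ r)" "s \<noteq> zero" using Limit(2) Limit_not_succ by blast+
  have "rec ?G s = tup (Suc N) (\<lambda>i. liminf s (\<lambda>r. app (app (graph ?G s) r) (num i)))"
    unfolding rec_graph[of ?G s] run_step_def[of _ _ _ _ s] using ns by simp
  then have "app (rec ?G s) (num i) = liminf s (\<lambda>r. app (app (graph ?G s) r) (num i))"
    using Limit.prems by simp
  also have "\<dots> = liminf s (\<lambda>r. track (c r) i)"
    by (rule liminf_cong) (use Limit.IH Limit.prems in simp)
  also have "\<dots> = track (c s) i" using c_track_Limit[OF Limit(1,2)] by simp
  finally show ?case .
qed

text \<open>Connects the run, a function of the ambient universe, with L: as oracle and start
  contents are in L, the tracks up to \<tau> coincide with definable terms, to which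
  \<open>regular_bound\<close> can be applied.\<close>

lemma definable_tracks:
  assumes "x \<in> L" "\<And>i. regs (start_config \<xi>s) i \<in> L"
  shows "\<exists>T. (\<forall>i t. DT t \<longrightarrow> DT (\<lambda>s. T i (t s))) \<and> (\<forall>i. \<forall>s\<in>elts (succ \<tau>). T i s = track (c s) i)"
proof -
  obtain N where N: "\<forall>cmd\<in>set P. \<forall>j\<in>cmd_regs cmd. j < N" using ex_reg_bound by blast
  let ?h = "track (start_config \<xi>s)"
  have hL: "?h i \<in> L" for i using assms(2) by (cases i) (simp_all add: Ord_in_L)
  let ?G = "run_step P x ?h (Suc N)"
  \<comment> \<open>Tracks up to \<open>N\<close> are read off the coded run; higher tracks belong
    to registers that \<open>P\<close> never mentions and are constants from L.\<close>
  define T where "T i s = (if i \<le> N then app (if Ord s then rec ?G s else zero) (num i) else ?h i)" for i s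
  have "DT (\<lambda>s. T i (t s))" if "DT t" for i t
    using that hL assms(1)
    by (cases "i \<le> N") (auto simp: T_def intro!: DT_app DT_rec DT2_run_step DT_num DT_const)
  moreover have "T i s = track (c s) i" if s: "s \<in> elts (succ \<tau>)" for i s
  proof (cases "i \<le> N")
    case True
    have "Ord s" using s Ord_tau Ord_in_Ord[of "succ \<tau>"] by (simp del: elts_succ)
    then show ?thesis using True coded_run[OF N True s] by (simp add: T_def)
  next
    case False
    then obtain j where "i = Suc j" "N \<le> j" by (cases i) auto
    then show ?thesis using unmentioned[OF N _ s, of j] by (simp add: T_def)
  qed
  ultimately show ?thesis by blast
qed

end

section \<open>Loops\<close>

lemma oadd_assoc: "oadd (oadd a b) c = oadd a (oadd b c)"
proof (induction c rule: eps_induct)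
  case (1 c)
  have "elts (oadd (oadd a b) c) = elts (oadd a (oadd b c))"
    using 1 by (simp add: elts_oadd[of _ c] elts_oadd[of _ b] elts_oadd[of a "oadd b c"] image_Un image_image Un_assoc)
  then show ?case by (simp only: elts_inject)
qed

lemma oadd_subset: "elts b \<subseteq> elts c \<Longrightarrow> elts (oadd a b) \<subseteq> elts (oadd a c)"
  by (auto simp: elts_oadd)

text \<open>Only tails matter for an inferior limit, and beyond \<open>a\<close> the tails of
  \<open>a + d\<close> are translates of tails of \<open>d\<close>.\<close>

lemma liminf_oadd:
  assumes "Ord a" "Limit d"
  shows "liminf (oadd a d) T = liminf d (\<lambda>e. T (oadd a e))"
proof -
  have od: "Ord d" using assms(2) LimitD by blast
  have "z \<in> elts (liminf (oadd a d) T) \<longleftrightarrow> z \<in> elts (liminf d (\<lambda>e. T (oadd a e)))" for z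
  proof
    assume "z \<in> elts (liminf (oadd a d) T)"
    then obtain s where s: "s \<in> elts (oadd a d)" "\<And>r. r \<in> elts (oadd a d) \<Longrightarrow> r \<notin> elts s \<Longrightarrow> z \<in> elts (T r)"
      unfolding mem_liminf by blast
    from s(1) consider "s \<in> elts a" | e where "e \<in> elts d" "s = oadd a e" by (auto simp: elts_oadd)
    then have "\<exists>e0\<in>elts d. \<forall>e\<in>elts d. e \<notin> elts e0 \<longrightarrow> oadd a e \<notin> elts s"
    proof cases
      case 1
      have "oadd a e \<notin> elts s" for e
        using 1 mem_asym[of s "oadd a e"] by (auto simp: elts_oadd)
      then show ?thesis using LimitD(3)[OF assms(2)] by blast
    next
      case (2 e0)
      then show ?thesis using oadd_mem_iff[OF assms(1)] Ord_in_Ord[OF od] by blast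
    qed
    then show "z \<in> elts (liminf d (\<lambda>e. T (oadd a e)))"
      unfolding mem_liminf using s(2) oadd_mono by meson
  next
    assume "z \<in> elts (liminf d (\<lambda>e. T (oadd a e)))"
    then obtain e0 where e0: "e0 \<in> elts d" "\<And>e. e \<in> elts d \<Longrightarrow> e \<notin> elts e0 \<Longrightarrow> z \<in> elts (T (oadd a e))"
      unfolding mem_liminf by blast
    have "z \<in> elts (T r)" if "r \<in> elts (oadd a d)" "r \<notin> elts (oadd a e0)" for r
      using that e0(2) by (auto simp: elts_oadd)
    then show "z \<in> elts (liminf (oadd a d) T)"
      unfolding mem_liminf using oadd_mono[OF e0(1)] by blast
  qed
  then have "elts (liminf (oadd a d) T) = elts (liminf d (\<lambda>e. T (oadd a e)))" by blast
  then show ?thesis by (simp only: elts_inject)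
qed

lemma liminf_eventually:
  assumes "Ord m" "s \<in> elts m" "\<And>r. r \<in> elts m \<Longrightarrow> r \<notin> elts s \<Longrightarrow> T r = a"
  shows "liminf m T = a"
proof -
  have "z \<in> elts (liminf m T) \<longleftrightarrow> z \<in> elts a" for z
  proof
    assume "z \<in> elts (liminf m T)"
    then obtain u where u: "u \<in> elts m" "\<And>r. r \<in> elts m \<Longrightarrow> r \<notin> elts u \<Longrightarrow> z \<in> elts (T r)"
      unfolding mem_liminf by blast
    show "z \<in> elts a"
    proof (cases "s \<in> elts u")
      case True
      then have "u \<notin> elts s" using mem_asym by blast
      then show ?thesis using u(2)[OF u(1)] assms(3)[OF u(1)] by simp
    next
      case False
      then show ?thesis using u(2)[OF assms(2)] assms(3)[OF assms(2)] by simp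
    qed
  next
    assume "z \<in> elts a"
    then show "z \<in> elts (liminf m T)" unfolding mem_liminf using assms(2,3) by blast
  qed
  then have "elts (liminf m T) = elts a" by blast
  then show ?thesis by (simp only: elts_inject)
qed

context run
begin

lemma time_le: "Ord r \<Longrightarrow> s \<in> elts (succ \<tau>) \<Longrightarrow> elts r \<subseteq> elts s \<Longrightarrow> r \<in> elts (succ \<tau>)"
  by (metis Ord_in_Ord Ord_in_succ_iff Ord_succ Ord_tau subset_trans)

lemma succ_time: "succ s \<in> elts (succ \<tau>) \<Longrightarrow> s \<in> elts \<tau>"
  using Ord_transD[OF Ord_tau, of "succ s" s] by auto

lemma halted_const:
  assumes s: "Ord s" "halted P (c s)" and r: "r \<in> elts (succ \<tau>)" and sr: "elts s \<subseteq> elts r"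
  shows "c r = c s"
  using Ord_tau r sr
proof (induction rule: Ord_induct_le)
  case zero
  then have "s = zero" by (simp add: zero_iff)
  then show ?case by simp
next
  case (succ r)
  have "s \<in> elts (succ r) \<or> s = succ r"
    using Ord_subset_iff[OF s(1), of "succ r"] succ.prems succ(2) by (simp del: elts_succ)
  then show ?case
  proof
    assume "s \<in> elts (succ r)"
    then have "c r = c s" using succ.IH Ord_in_succ_iff[OF s(1) succ(2)] by blast
    then show ?thesis using c_succ[OF succ(1)] s(2) by (simp add: step_def)
  qed simp
next
  case (Limit r)
  have "s \<in> elts r \<or> s = r" using Ord_subset_iff[OF s(1) LimitD(1)[OF Limit(2)]] Limit.prems by blast
  then show ?case
  proof
    assume sr: "s \<in> elts r"
    have "c q = c s" if "q \<in> elts r" "q \<notin> elts s" for q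
      using Limit.IH[OF that(1)] Ord_not_in[of q s] s(1) Ord_in_Ord[OF LimitD(1)[OF Limit(2)] that(1)] that(2) by blast
    then have "track (c r) i = track (c s) i" for i
      unfolding c_track_Limit[OF Limit(1,2)]
      by (intro liminf_eventually[OF LimitD(1)[OF Limit(2)] sr]) simp
    then show ?thesis by (rule config_eqI)
  qed simp
qed

text \<open>A configuration determines its future: steps depend on nothing else, and inferior limits
  depend only on tails, so they do not see the different starting times.\<close>

lemma shift_run:
  assumes a: "Ord a" and b: "Ord b" and ab: "c a = c b"
    and "Ord d" "oadd a d \<in> elts (succ \<tau>)" "oadd b d \<in> elts (succ \<tau>)"
  shows "c (oadd a d) = c (oadd b d)"
  using assms(4-)
proof (induction d rule: eps_induct)
  case (1 d)
  have IH: "c (oadd a e) = c (oadd b e)" if "e \<in> elts d" for e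
    using 1(1)[OF that] Ord_in_Ord[OF 1(2) that] time_trans[OF 1(3)] time_trans[OF 1(4)] oadd_mono[OF that] by blast
  from 1(2) show ?case
  proof (cases rule: Ord_cases)
    case 1
    then show ?thesis using ab by simp
  next
    case (2 e)
    have "oadd a e \<in> elts \<tau>" "oadd b e \<in> elts \<tau>"
      using \<open>oadd a d \<in> _\<close> \<open>oadd b d \<in> _\<close> 2(2) succ_time by (simp_all only: oadd_succ)
    moreover have "c (oadd a e) = c (oadd b e)" using IH[of e] 2(2) by simp
    ultimately show ?thesis using 2(2) c_succ by simp
  next
    case 3
    have "track (c (oadd a d)) i = track (c (oadd b d)) i" for i
    proof -
      have "track (c (oadd a d)) i = liminf d (\<lambda>e. track (c (oadd a e)) i)"
        using c_track_Limit[OF 1(3) Limit_oadd[OF a 3]] liminf_oadd[OF a 3] by simp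
      also have "\<dots> = liminf d (\<lambda>e. track (c (oadd b e)) i)"
        by (rule liminf_cong) (simp add: IH)
      also have "\<dots> = track (c (oadd b d)) i"
        using c_track_Limit[OF 1(4) Limit_oadd[OF b 3]] liminf_oadd[OF b 3] by simp
      finally show ?thesis .
    qed
    then show ?thesis by (rule config_eqI)
  qed
qed

text \<open>Equality at \<open>a\<close> and \<open>a + d\<close> handles only finite repetition. At
  a limit of recurrences, \<open>ge\<close> keeps the inferior limit from dropping below the tracks
  of \<open>c a\<close>, and recurrence keeps it from exceeding them. Hence the recurrence times up
  to \<open>e\<close> have a last element \<open>k\<close>. The remainder of \<open>e\<close> after
  \<open>k\<close> is below \<open>d\<close>, since otherwise \<open>k + d\<close> would be a later
  recurrence.\<close>

lemma loop:
  assumes a: "Ord a" and d: "Ord d" "d \<noteq> zero" and bt: "oadd a d \<in> elts (succ \<tau>)"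
    and eq: "c (oadd a d) = c a"
    and ge: "\<And>e i. e \<in> elts d \<Longrightarrow> elts (track (c a) i) \<subseteq> elts (track (c (oadd a e)) i)"
  shows "Ord e \<Longrightarrow> oadd a e \<in> elts (succ \<tau>) \<Longrightarrow> \<exists>e'\<in>elts d. c (oadd a e) = c (oadd a e')"
proof (induction e rule: eps_induct)
  case (1 e)
  note oe = \<open>Ord e\<close> and et = \<open>oadd a e \<in> elts (succ \<tau>)\<close>
  have IH: "elts (track (c a) i) \<subseteq> elts (track (c (oadd a f)) i)" if f: "f \<in> elts e" for f i
  proof -
    have "oadd a f \<in> elts (succ \<tau>)" using time_trans[OF et oadd_mono[OF f]] .
    then obtain e' where "e' \<in> elts d" "c (oadd a f) = c (oadd a e')"
      using 1(1)[OF f Ord_in_Ord[OF oe f]] by blast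
    then show ?thesis using ge by simp
  qed
  \<comment> \<open>the last time at which the configuration at \<open>a\<close> recurs\<close>
  define S where "S = {k \<in> elts (succ e). c (oadd a k) = c a}"
  have sS: "small S" unfolding S_def by (rule small_Collect)
  have oS: "Ord k" "elts k \<subseteq> elts e" if "k \<in> S" for k
  proof -
    have k: "k \<in> elts (succ e)" using that by (simp add: S_def)
    then show "Ord k" using oe Ord_in_Ord[of "succ e" k] by (simp del: elts_succ)
    then show "elts k \<subseteq> elts e" using k Ord_in_succ_iff oe by blast
  qed
  have z: "zero \<in> S" using Ord_mem_zero[of "succ e"] oe by (auto simp: S_def)
  define k where "k = vset (\<Union>x\<in>S. elts x)"
  have ok: "Ord k" unfolding k_def by (rule Ord_UN[OF sS]) (rule oS)
  have ek: "elts k = (\<Union>x\<in>S. elts x)" unfolding k_def by (rule elts_vset, rule small_UN[OF sS]) simp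
  have ke: "elts k \<subseteq> elts e" unfolding ek using oS by blast
  \<comment> \<open>A supremum outside \<open>S\<close> is approached by recurrences without being
    one, which leaves only the limit case; there the recurring configuration is also the inferior
    limit.\<close>
  have kS: "k \<in> S"
  proof (rule ccontr)
    assume no: "k \<notin> S"
    have below: "\<exists>q\<in>S. q \<in> elts k \<and> p \<in> elts q" if p: "p \<in> elts k" for p
    proof -
      obtain q where q: "q \<in> S" "p \<in> elts q" using p ek by blast
      then have "elts q \<subseteq> elts k" using ek by blast
      then have "q \<in> elts k" using Ord_subset_iff[OF oS(1)[OF q(1)] ok] q no by blast
      then show ?thesis using q by blast
    qed
    from ok show False
    proof (cases rule: Ord_cases)
      case 1
      then show False using z no by simp
    next
      case (2 p)
      then obtain q where "q \<in> elts k" "p \<in> elts q" using below[of p] by auto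
      then show False using 2(2) mem_asym[of p q] by auto
    next
      case 3
      have kt: "oadd a k \<in> elts (succ \<tau>)"
        by (rule time_le[OF Ord_oadd[OF a ok] et oadd_subset[OF ke]])
      have "track (c (oadd a k)) i = track (c a) i" for i
      proof -
        have "track (c (oadd a k)) i = liminf k (\<lambda>e. track (c (oadd a e)) i)"
          using c_track_Limit[OF kt Limit_oadd[OF a 3]] liminf_oadd[OF a 3] by simp
        moreover have "elts (track (c a) i) \<subseteq> elts (liminf k (\<lambda>e. track (c (oadd a e)) i))"
          unfolding subset_iff mem_liminf using IH ke LimitD(3)[OF 3] by blast
        moreover have "elts (liminf k (\<lambda>e. track (c (oadd a e)) i)) \<subseteq> elts (track (c a) i)"
        proof
          fix w assume "w \<in> elts (liminf k (\<lambda>e. track (c (oadd a e)) i))"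
          then obtain s where s: "s \<in> elts k"
            "\<And>r. r \<in> elts k \<Longrightarrow> r \<notin> elts s \<Longrightarrow> w \<in> elts (track (c (oadd a r)) i)"
            unfolding mem_liminf by blast
          obtain q where q: "q \<in> S" "q \<in> elts k" "s \<in> elts q" using below[OF s(1)] by blast
          then have "w \<in> elts (track (c (oadd a q)) i)" using s(2) mem_asym by blast
          then show "w \<in> elts (track (c a) i)" using q(1) by (simp add: S_def)
        qed
        ultimately show ?thesis by (metis elts_inject subset_antisym)
      qed
      then have "c (oadd a k) = c a" by (rule config_eqI)
      then show False using no Ord_in_succ_iff[OF ok oe] ke by (simp add: S_def del: elts_succ)
    qed
  qed
  then have ck: "c (oadd a k) = c a" by (simp add: S_def)
  obtain f where f: "Ord f" "oadd k f = e" using oadd_surj[OF ok oe ke] by blast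
  have sub: "g \<in> elts (oadd k g) \<or> g = oadd k g" if "Ord g" for g
    using subset_oadd[OF ok that] Ord_subset_iff[OF that Ord_oadd[OF ok that]] by blast
  have rep: "c (oadd a (oadd k g)) = c (oadd a g)" if g: "Ord g" "elts (oadd k g) \<subseteq> elts e" for g
  proof -
    have okg: "Ord (oadd k g)" using ok g by simp
    have t: "oadd a (oadd k g) \<in> elts (succ \<tau>)"
      by (rule time_le[OF Ord_oadd[OF a okg] et oadd_subset[OF g(2)]])
    moreover have "oadd a g \<in> elts (succ \<tau>)"
      by (rule time_le[OF Ord_oadd[OF a g(1)] t oadd_subset[OF subset_oadd[OF ok g(1)]]])
    ultimately show ?thesis
      using shift_run[OF Ord_oadd[OF a ok] a ck g(1)] by (simp add: oadd_assoc)
  qed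
  show ?case
  proof (cases "f \<in> elts d")
    case True
    then show ?thesis using rep[OF f(1)] f(2) by auto
  next
    case False
    then have "elts d \<subseteq> elts f" using Ord_not_in f d by blast
    then have le: "elts (oadd k d) \<subseteq> elts e" using oadd_subset[of d f k] f(2) by simp
    then have "c (oadd a (oadd k d)) = c a" using rep[OF d(1)] eq by simp
    moreover have "oadd k d \<in> elts (succ e)" using Ord_in_succ_iff[OF Ord_oadd[OF ok d(1)] oe] le by blast
    ultimately have "oadd k d \<in> S" by (simp add: S_def del: elts_succ)
    then have "elts (oadd k d) \<subseteq> elts k" using ek by blast
    moreover have "k \<in> elts (oadd k d)" using oadd_mono[OF Ord_mem_zero[OF d], of k] by simp
    ultimately show ?thesis by (meson mem_irrefl subsetD)
  qed
qed

end

section \<open>Earlier occurrence of the configuration at time \<open>\<alpha>\<close>\<close>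

text \<open>The least witness in \<open>a\<close>, written as an intersection so that it becomes a
  definable term and can serve as a choice function. Without witnesses its value is
  \<open>a\<close>.\<close>

definition first :: "'v::zfc_universe \<Rightarrow> ('v \<Rightarrow> bool) \<Rightarrow> 'v" where
  "first a F = vset {w \<in> elts a. \<forall>y\<in>elts a. F y \<longrightarrow> w \<in> elts y}"

lemma first:
  assumes "Ord a" "y \<in> elts a" "F y"
  shows "first a F \<in> elts a" "F (first a F)"
proof -
  have "Ord y" using assms Ord_in_Ord by blast
  then obtain b where b: "Ord b" "F b" "\<And>c. c \<in> elts b \<Longrightarrow> \<not> F c" "elts b \<subseteq> elts y"
    using Ord_least[of y F] assms(3) by blast
  have ba: "b \<in> elts a" using Ord_subset_iff[OF b(1) \<open>Ord y\<close>] b(4) Ord_transD[OF assms(1,2)] assms(2) by blast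
  have "elts b \<subseteq> elts z" if "z \<in> elts a" "F z" for z
    using b(1,3) that Ord_not_in Ord_in_Ord[OF assms(1)] by blast
  then have "{w \<in> elts a. \<forall>y\<in>elts a. F y \<longrightarrow> w \<in> elts y} = elts b"
    using ba b(2) Ord_transD[OF assms(1) ba] by blast
  then have "first a F = b" by (simp add: first_def)
  then show "first a F \<in> elts a" "F (first a F)" using ba b by simp_all
qed

lemma DT_first:
  assumes "a \<in> L" "D (\<lambda>s. F (\<lambda>n. s (Suc n)) (s 0))"
  shows "DT (\<lambda>s. first a (F s))"
  unfolding first_def
  by (intro DT_Collect DT_const assms(1) D_ball D_imp D_mem DT_var D_shift1[OF assms(2)])

lemma D_all_less:
  assumes "\<And>i. i < M \<Longrightarrow> D (\<lambda>s. F s i)"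
  shows "D (\<lambda>s. \<forall>i<(M::nat). F s i)"
  using assms
proof (induction M)
  case (Suc M)
  then have "D (\<lambda>s. F s M \<and> (\<forall>i<M. F s i))" by (intro D_conj) simp_all
  then show ?case by (simp add: All_less_Suc)
qed (simp add: D_triv)

text \<open>Finitely many bounds are merged by union. The hypothesis asks for persistence above
  \<open>b\<close>, since the merged bound may exceed the individual ones.\<close>

lemma finite_bound:
  assumes "Limit a" "\<And>i. i < (M::nat) \<Longrightarrow> \<exists>b\<in>elts a. \<forall>b'\<in>elts a. elts b \<subseteq> elts b' \<longrightarrow> Q i b'"
  shows "\<exists>b\<in>elts a. \<forall>i<M. Q i b"
proof -
  have "\<exists>b\<in>elts a. \<forall>i<M. \<forall>b'\<in>elts a. elts b \<subseteq> elts b' \<longrightarrow> Q i b'"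
    using assms(2)
  proof (induction M)
    case 0
    then show ?case using LimitD(3)[OF assms(1)] by auto
  next
    case (Suc M)
    then obtain b where b: "b \<in> elts a" "\<forall>i<M. \<forall>b'\<in>elts a. elts b \<subseteq> elts b' \<longrightarrow> Q i b'" by auto
    obtain d where d: "d \<in> elts a" "\<forall>b'\<in>elts a. elts d \<subseteq> elts b' \<longrightarrow> Q M b'" using Suc.prems by blast
    let ?u = "vset (elts b \<union> elts d)"
    have "?u \<in> elts a" using Ord_Un_mem LimitD(1)[OF assms(1)] b d by blast
    moreover have "\<forall>i<Suc M. \<forall>b'\<in>elts a. elts ?u \<subseteq> elts b' \<longrightarrow> Q i b'"
      using b(2) d(2) by (auto simp: less_Suc_eq)
    ultimately show ?case by blast
  qed
  then show ?thesis by blast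
qed

context regular_in_L
begin

lemma Ord_below: "r \<in> elts \<alpha> \<Longrightarrow> Ord r"
  using Ord_alpha Ord_in_Ord by blast

lemma below_trans: "r \<in> elts \<alpha> \<Longrightarrow> q \<in> elts r \<Longrightarrow> q \<in> elts \<alpha>"
  using Ord_alpha Ord_transD by blast

lemma alpha_L: "\<alpha> \<in> L"
  using Ord_alpha Ord_in_L by blast

text \<open>Each member \<open>z\<close> of the inferior limit has a first stage from which on it
  stays below the track. These stages form a definable function on the inferior limit, which is
  below \<alpha>, so regularity bounds them uniformly.\<close>

lemma liminf_attained:
  assumes T: "\<And>t. DT t \<Longrightarrow> DT (\<lambda>s. T (t s))"
    and A: "liminf \<alpha> T \<in> elts \<alpha>"
  shows "\<exists>b\<in>elts \<alpha>. \<forall>r\<in>elts \<alpha>. r \<notin> elts b \<longrightarrow> elts (liminf \<alpha> T) \<subseteq> elts (T r)"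
proof -
  define F where "F z y \<longleftrightarrow> (\<forall>r\<in>elts \<alpha>. r \<notin> elts y \<longrightarrow> z \<in> elts (T r))" for z y
  have F: "first \<alpha> (F z) \<in> elts \<alpha> \<and> F z (first \<alpha> (F z))" if z: "z \<in> elts (liminf \<alpha> T)" for z
  proof -
    obtain y where "y \<in> elts \<alpha>" "F z y" using z unfolding mem_liminf F_def by blast
    then show ?thesis using first[OF Ord_alpha, of y "F z"] by blast
  qed
  have "DT (\<lambda>s. first \<alpha> (F (s 0)))"
    unfolding F_def
    by (intro DT_first alpha_L D_ball D_imp D_not D_mem T DT_var DT_const)
  from regular_bound[OF this A] F obtain g where
    g: "g \<in> elts \<alpha>" "\<forall>z\<in>elts (liminf \<alpha> T). first \<alpha> (F z) \<in> elts g" by blast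
  have "z \<in> elts (T r)" if "r \<in> elts \<alpha>" "r \<notin> elts g" "z \<in> elts (liminf \<alpha> T)" for r z
  proof -
    have "elts g \<subseteq> elts r" using that Ord_not_in Ord_below g(1) by blast
    then have "r \<notin> elts (first \<alpha> (F z))" using g(2) that(3) mem_asym by blast
    then show ?thesis using F[OF that(3)] that(1) unfolding F_def by blast
  qed
  then show ?thesis using g(1) by blast
qed

text \<open>Past \<open>b\<close> no track falls below its limit value, and the limit values recur
  cofinally in \<alpha>. The supremum \<mu> of \<omega> successive intervals, in each of which all
  these values occur, has the same inferior limits: the lower bound gives one inclusion, recurrence
  the other.\<close>

lemma liminf_reflects:
  fixes T :: "nat \<Rightarrow> 'v \<Rightarrow> 'v"
  assumes T: "\<And>i t. DT t \<Longrightarrow> DT (\<lambda>s. T i (t s))"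
    and Ta: "\<And>i r. r \<in> elts \<alpha> \<Longrightarrow> T i r \<in> elts \<alpha>"
    and A: "\<And>i. liminf \<alpha> (T i) \<in> elts \<alpha>"
  shows "\<exists>\<mu>\<in>elts \<alpha>. Limit \<mu> \<and> (\<forall>i<M. liminf \<mu> (T i) = liminf \<alpha> (T i)) \<and>
    (\<forall>i<M. \<forall>r\<in>elts \<alpha>. r \<notin> elts \<mu> \<longrightarrow> elts (liminf \<alpha> (T i)) \<subseteq> elts (T i r))"
proof -
  let ?A = "\<lambda>i. liminf \<alpha> (T i)"
  have "\<exists>b\<in>elts \<alpha>. \<forall>i<M. \<forall>r\<in>elts \<alpha>. r \<notin> elts b \<longrightarrow> elts (?A i) \<subseteq> elts (T i r)"
  proof (rule finite_bound[OF Limit_alpha])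
    fix i
    show "\<exists>b\<in>elts \<alpha>. \<forall>b'\<in>elts \<alpha>. elts b \<subseteq> elts b' \<longrightarrow> (\<forall>r\<in>elts \<alpha>. r \<notin> elts b' \<longrightarrow> elts (?A i) \<subseteq> elts (T i r))"
      using liminf_attained[OF T A, of i] by blast
  qed
  then obtain b where b: "b \<in> elts \<alpha>"
    and ge: "\<And>i r. i < M \<Longrightarrow> r \<in> elts \<alpha> \<Longrightarrow> r \<notin> elts b \<Longrightarrow> elts (?A i) \<subseteq> elts (T i r)" by blast
  \<comment> \<open>Were the limit value avoided from \<open>s\<close> on, every later value would
    be strictly larger and contain \<open>?A i\<close>; then the inferior limit would be a member of
    itself.\<close>
  have recur: "\<exists>r\<in>elts \<alpha>. r \<notin> elts s \<and> T i r = ?A i"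
    if s: "s \<in> elts \<alpha>" "elts b \<subseteq> elts s" and i: "i < M" for s i
  proof (rule ccontr)
    assume no: "\<not> ?thesis"
    have "?A i \<in> elts (T i r)" if r: "r \<in> elts \<alpha>" "r \<notin> elts s" for r
    proof -
      have "elts (?A i) \<subseteq> elts (T i r)" using ge[OF i r(1)] s(2) r(2) by blast
      moreover have "T i r \<noteq> ?A i" using no r by blast
      ultimately show ?thesis using Ord_subset_iff[OF Ord_below[OF A] Ord_below[OF Ta[OF r(1)]]] by metis
    qed
    then have "?A i \<in> elts (?A i)" unfolding mem_liminf[of _ \<alpha>] using s(1) by blast
    then show False by simp
  qed
  define F where "F s y \<longleftrightarrow> s \<in> elts y \<and> (\<forall>i<M. \<exists>r\<in>elts y. r \<notin> elts s \<and> T i r = ?A i)" for s y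
  \<comment> \<open>\<open>nx s\<close> ends the shortest interval from \<open>s\<close> on in which
    all \<open>M\<close> tracks take their limit values; iterating it makes every value recur
    cofinally below \<mu>.\<close>
  define nx where "nx s = first \<alpha> (F s)" for s
  have nx: "nx s \<in> elts \<alpha>" "F s (nx s)" if s: "s \<in> elts \<alpha>" "elts b \<subseteq> elts s" for s
  proof -
    have "\<exists>y\<in>elts \<alpha>. \<forall>i<M. \<exists>r\<in>elts y. r \<notin> elts s \<and> T i r = ?A i"
    proof (rule finite_bound[OF Limit_alpha])
      fix i assume "i < M"
      then obtain r where r: "r \<in> elts \<alpha>" "r \<notin> elts s" "T i r = ?A i" using recur[OF s] by blast
      have "r \<in> elts (succ r)" by simp
      then show "\<exists>y\<in>elts \<alpha>. \<forall>y'\<in>elts \<alpha>. elts y \<subseteq> elts y' \<longrightarrow> (\<exists>r\<in>elts y'. r \<notin> elts s \<and> T i r = ?A i)"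
        using r LimitD(2)[OF Limit_alpha r(1)] by blast
    qed
    then obtain y where y: "y \<in> elts \<alpha>" "\<forall>i<M. \<exists>r\<in>elts y. r \<notin> elts s \<and> T i r = ?A i" by blast
    let ?y = "vset (elts y \<union> elts (succ s))"
    have "?y \<in> elts \<alpha>" using Ord_Un_mem[OF Ord_alpha y(1) LimitD(2)[OF Limit_alpha s(1)]] .
    moreover have "F s ?y" unfolding F_def using y(2) by auto
    ultimately show "nx s \<in> elts \<alpha>" "F s (nx s)" unfolding nx_def using first[OF Ord_alpha] by blast+
  qed
  have DTnx: "DT (\<lambda>s. nx (t s))" if "DT t" for t
    unfolding nx_def F_def
    by (intro DT_first alpha_L D_conj D_all_less D_bex D_not D_mem D_eq T DT_var DT_Ord[OF Ord_below[OF A]] DT_shift that)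
  define a where "a = rec_nat b (\<lambda>_. nx)"
  have a0: "a 0 = b" and aS: "a (Suc n) = nx (a n)" for n by (simp_all add: a_def)
  have a: "a n \<in> elts \<alpha> \<and> elts b \<subseteq> elts (a n)" for n
  proof (induction n)
    case (Suc n)
    then have "nx (a n) \<in> elts \<alpha>" "a n \<in> elts (nx (a n))" using nx unfolding F_def by blast+
    then show ?case using Suc Ord_transD[OF Ord_below, of "nx (a n)" "a n"] unfolding aS by blast
  qed (use b a0 in simp)
  have Fa: "F (a n) (a (Suc n))" for n using nx a unfolding aS by blast
  have amem: "a n \<in> elts (a (Suc n))" for n using Fa unfolding F_def by blast
  have asub: "elts (a n) \<subseteq> elts (a (Suc n))" for n
    using amem[of n] Ord_transD[OF Ord_below] a by blast
  have aU: "elts b \<union> (\<Union>m<n. elts (a (Suc m))) = elts (a n)" for n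
  proof (induction n)
    case (Suc n)
    then show ?case using asub[of n] by (auto simp: lessThan_Suc)
  qed (simp add: a0)
  \<comment> \<open>The same iteration as a recursion in L. \<open>G\<close> recovers the previous
    term as a union instead of by a predecessor: the values collected so far, together with
    \<open>b\<close>, unite to \<open>a n\<close>. At \<open>num n\<close> the result is therefore
    \<open>a (Suc n)\<close>.\<close>
  define G where "G n f = nx (vset (elts b \<union> elts (vset (\<Union>m\<in>elts n. elts (app f m)))))" for n f
  have DG: "DT2 G"
    unfolding DT2_def G_def
    by (intro allI impI DTnx DT_union DT_Ord[OF Ord_below[OF b]] DT_UN DT_app DT_var DT_shift)
  have recG: "rec G (num n) = a (Suc n)" for n
  proof (induction n rule: less_induct)
    case (less n)
    have "(\<Union>m\<in>elts (num n). elts (app (graph G (num n)) m)) = (\<Union>m<n. elts (a (Suc m)))"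
      unfolding elts_num using less by (simp add: elts_num)
    then have "rec G (num n) = nx (vset (elts b \<union> elts (vset (\<Union>m<n. elts (a (Suc m))))))"
      unfolding rec_graph[of G] G_def by simp
    also have "elts (vset (\<Union>m<n. elts (a (Suc m)))) = (\<Union>m<n. elts (a (Suc m)))"
      by (rule elts_vset, rule small_subset[of "elts (a n)"]) (use aU[of n] in auto)
    finally show ?case unfolding aU by (simp add: aS[of n])
  qed
  have "DT (\<lambda>s. if Ord (s 0) then rec G (s 0) else zero)" by (intro DT_rec DG DT_var)
  moreover have "(if Ord n then rec G n else zero) \<in> elts \<alpha>" if "n \<in> elts omega" for n
    using that recG a by auto
  \<comment> \<open>Here uncountability enters: the domain is \<omega> < \<alpha>, so the whole
    sequence is bounded below \<alpha> and its supremum cannot reach \<alpha>.\<close>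
  ultimately obtain g where
    g: "g \<in> elts \<alpha>" "\<forall>n\<in>elts (omega :: 'v). (if Ord n then rec G n else zero) \<in> elts g"
    using regular_bound[of "\<lambda>n. if Ord n then rec G n else zero" omega, OF _ omega_in_alpha] by blast
  have ag: "a (Suc n) \<in> elts g" for n using g(2) recG[of n, symmetric] by simp
  define \<mu> where "\<mu> = vset (\<Union>x\<in>range a. elts x)"
  have em: "elts \<mu> = (\<Union>n. elts (a n))" by (simp add: \<mu>_def)
  have om: "Ord \<mu>" unfolding \<mu>_def by (rule Ord_UN) (use a Ord_below in auto)
  have "elts \<mu> \<subseteq> elts g"
    unfolding em using asub ag Ord_transD[OF Ord_below[OF g(1)]] by blast
  then have "\<mu> \<in> elts g \<or> \<mu> = g" using Ord_subset_iff[OF om Ord_below[OF g(1)]] by blast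
  then have m: "\<mu> \<in> elts \<alpha>" using g(1) below_trans by blast
  have am: "a n \<in> elts \<mu>" for n using em amem by blast
  have "Limit \<mu>"
    unfolding Limit_def
  proof (intro conjI ballI om)
    show "\<mu> \<noteq> zero" using am[of 0] by auto
    fix r assume "r \<in> elts \<mu>"
    then obtain n where "r \<in> elts (a n)" using em by blast
    then have "succ r \<in> elts (succ (a n))" using Ord_succ_mem_succ Ord_below a by blast
    then have "succ r \<in> elts (a n) \<or> succ r = a n" by (auto simp del: elts_succ simp: elts_succ[of "a n"])
    then show "succ r \<in> elts \<mu>" using am Ord_transD[OF om am] by metis
  qed
  moreover have "liminf \<mu> (T i) = ?A i" if i: "i < M" for i
  proof -
    have "elts (?A i) \<subseteq> elts (liminf \<mu> (T i))"
      unfolding subset_iff mem_liminf[of _ \<mu>] using ge[OF i] am[of 0] below_trans[OF m] unfolding a0 by blast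
    moreover have "elts (liminf \<mu> (T i)) \<subseteq> elts (?A i)"
    proof
      fix z assume "z \<in> elts (liminf \<mu> (T i))"
      then obtain s where s: "s \<in> elts \<mu>" "\<And>r. r \<in> elts \<mu> \<Longrightarrow> r \<notin> elts s \<Longrightarrow> z \<in> elts (T i r)"
        unfolding mem_liminf by blast
      obtain n where n: "s \<in> elts (a n)" using s(1) em by blast
      obtain r where r: "r \<in> elts (a (Suc n))" "r \<notin> elts (a n)" "T i r = ?A i"
        using Fa[of n] i unfolding F_def by blast
      have "r \<notin> elts s" using r(2) n Ord_transD[OF Ord_below] a by blast
      moreover have "r \<in> elts \<mu>" using r(1) em by blast
      ultimately show "z \<in> elts (?A i)" using s(2) r(3) by metis
    qed
    ultimately show ?thesis by (metis elts_inject subset_antisym)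
  qed
  moreover have "elts (?A i) \<subseteq> elts (T i r)" if "i < M" "r \<in> elts \<alpha>" "r \<notin> elts \<mu>" for i r
    using ge[OF that(1,2)] that(3) em a0 by blast
  ultimately show ?thesis using m by blast
qed

end

section \<open>Recognizability\<close>

text \<open>A halted machine idles, so the halting time in the definition may be a late one. Cutting
  the run at the first halting time is what makes a loop contradictory.\<close>

lemma halts_least:
  assumes "wITRM_halts_with \<alpha> P x \<xi>s v"
  obtains \<tau> c where "run P x \<xi>s \<tau> c" "\<And>\<sigma> i. \<sigma> \<in> elts (succ \<tau>) \<Longrightarrow> regs (c \<sigma>) i \<in> elts \<alpha>"
    "halted P (c \<tau>)" "regs (c \<tau>) 0 = v" "\<And>\<sigma>. \<sigma> \<in> elts \<tau> \<Longrightarrow> \<not> halted P (c \<sigma>)"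
proof -
  obtain \<tau> c where t: "Ord \<tau>" "computation P x \<xi>s \<tau> c"
    "\<forall>\<sigma>\<in>elts (succ \<tau>). \<forall>i. regs (c \<sigma>) i \<in> elts \<alpha>" "halted P (c \<tau>)" "regs (c \<tau>) 0 = v"
    using assms unfolding wITRM_halts_with_def by blast
  interpret run P x \<xi>s \<tau> c using t by unfold_locales
  obtain \<sigma> where s: "Ord \<sigma>" "halted P (c \<sigma>)" "\<And>\<rho>. \<rho> \<in> elts \<sigma> \<Longrightarrow> \<not> halted P (c \<rho>)" "elts \<sigma> \<subseteq> elts \<tau>"
    using Ord_least[of \<tau> "\<lambda>\<sigma>. halted P (c \<sigma>)"] t by blast
  have "c \<tau> = c \<sigma>" by (rule halted_const[OF s(1,2) _ s(4)]) simp
  have sub: "elts (succ \<sigma>) \<subseteq> elts (succ \<tau>)"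
    using s(4) Ord_subset_iff[OF s(1) t(1)] by auto
  have "computation P x \<xi>s \<sigma> c"
    using t(2) s(4) sub unfolding computation_def by blast
  then have "run P x \<xi>s \<sigma> c" using s(1) by unfold_locales
  then show ?thesis using that[of \<sigma> c] t s \<open>c \<tau> = c \<sigma>\<close> sub by (metis subsetD)
qed

lemma step_oracle:
  assumes "\<And>j. j \<in> cmd_regs (P ! active_line C) \<Longrightarrow> \<not> halted P C \<Longrightarrow> regs C j \<in> elts x \<longleftrightarrow> regs C j \<in> elts y"
  shows "step P x C = step P y C"
proof (cases "halted P C")
  case False
  then show ?thesis using assms by (cases C; cases "P ! active_line C") (auto simp: step_def)
qed (simp add: step_def)

text \<open>Agreement is claimed only at times common to both runs, as \<open>c\<close> and
  \<open>c'\<close> are arbitrary beyond them. The hypothesis on the oracles covers the contents of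
  all mentioned registers before \<tau>, which includes every query.\<close>

lemma run_unique:
  assumes x: "run P x \<xi>s \<tau> c" and y: "run P y \<xi>s \<tau>' c'"
    and xy: "\<And>\<sigma> cmd j. \<sigma> \<in> elts \<tau> \<Longrightarrow> cmd \<in> set P \<Longrightarrow> j \<in> cmd_regs cmd \<Longrightarrow>
       regs (c \<sigma>) j \<in> elts x \<longleftrightarrow> regs (c \<sigma>) j \<in> elts y"
    and s: "\<sigma> \<in> elts (succ \<tau>)" "\<sigma> \<in> elts (succ \<tau>')"
  shows "c \<sigma> = c' \<sigma>"
  using run.Ord_tau[OF x] s
proof (induction rule: Ord_induct_le)
  case zero
  then show ?case using run.c_zero[OF x] run.c_zero[OF y] by simp
next
  case (succ \<sigma>)
  have s': "\<sigma> \<in> elts \<tau>'" using run.succ_time[OF y succ.prems] .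
  then have "c \<sigma> = c' \<sigma>" using succ.IH by simp
  moreover have "step P x (c \<sigma>) = step P y (c \<sigma>)"
    by (rule step_oracle, rule xy[OF succ(1)]) (auto simp: halted_def)
  ultimately show ?case using run.c_succ[OF x succ(1)] run.c_succ[OF y s'] by simp
next
  case (Limit \<sigma>)
  have "track (c \<sigma>) i = track (c' \<sigma>) i" for i
    unfolding run.c_track_Limit[OF x Limit(1,2)] run.c_track_Limit[OF y Limit.prems Limit(2)]
    by (rule liminf_cong) (use Limit.IH run.time_trans[OF y Limit.prems] in simp)
  then show ?case by (rule config_eqI)
qed

text \<open>If \<tau> were at least \<alpha>, the time \<alpha> would belong to the run and its
  tracks there would lie below \<alpha>. The passage from \<mu> to \<alpha> then satisfies
  \<open>loop\<close>, so the halting configuration already occurs in it, before \<tau>, against the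
  minimality of \<tau>.\<close>

lemma (in regular_in_L) halts_early:
  assumes r: "run P x [\<xi>] \<tau> c" and x: "x \<in> L" and xi: "\<xi> \<in> elts \<alpha>"
    and bd: "\<And>\<sigma> i. \<sigma> \<in> elts (succ \<tau>) \<Longrightarrow> regs (c \<sigma>) i \<in> elts \<alpha>"
    and h: "halted P (c \<tau>)" and nh: "\<And>\<sigma>. \<sigma> \<in> elts \<tau> \<Longrightarrow> \<not> halted P (c \<sigma>)"
    and T: "\<And>i t. DT t \<Longrightarrow> DT (\<lambda>s. T i (t s))"
    and Tc: "\<And>i s. s \<in> elts (succ \<tau>) \<Longrightarrow> T i s = track (c s) i"
  shows "\<tau> \<in> elts \<alpha>"
proof (rule ccontr)
  assume no: "\<tau> \<notin> elts \<alpha>"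
  interpret run P x "[\<xi>]" \<tau> c by (rule r)
  have sub: "elts \<alpha> \<subseteq> elts \<tau>" using no Ord_not_in Ord_tau Ord_alpha by blast
  then have at: "\<alpha> \<in> elts (succ \<tau>)" using Ord_in_succ_iff Ord_tau Ord_alpha by blast
  have Ta: "T i s \<in> elts \<alpha>" if "s \<in> elts (succ \<tau>)" for i s
    unfolding Tc[OF that] using bd[OF that] by (cases i) simp_all
  have lim: "liminf m (T i) = track (c m) i" if "m \<in> elts (succ \<tau>)" "Limit m" for m i
    unfolding c_track_Limit[OF that] using Tc time_trans[OF that(1)] by (auto intro: liminf_cong)
  obtain N where N: "\<forall>cmd\<in>set P. \<forall>j\<in>cmd_regs cmd. j < N" using ex_reg_bound by blast
  have "liminf \<alpha> (T i) \<in> elts \<alpha>" for i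
    using lim[OF at Limit_alpha, of i] Tc[OF at, of i] Ta[OF at, of i] by simp
  then obtain \<mu> where m: "\<mu> \<in> elts \<alpha>" "Limit \<mu>"
    and eq: "\<forall>i<Suc N. liminf \<mu> (T i) = liminf \<alpha> (T i)"
    and ge: "\<forall>i<Suc N. \<forall>r\<in>elts \<alpha>. r \<notin> elts \<mu> \<longrightarrow> elts (liminf \<alpha> (T i)) \<subseteq> elts (T i r)"
    using liminf_reflects[of T "Suc N", OF T Ta[OF time_trans[OF at]]] by blast
  have mt: "\<mu> \<in> elts (succ \<tau>)" using time_trans[OF at m(1)] .
  \<comment> \<open>Only tracks up to \<open>N\<close> go through \<open>liminf_reflects\<close>;
    the others never change.\<close>
  have const: "track (c r) i = track (c \<alpha>) i" if i: "\<not> i < Suc N" and r: "r \<in> elts (succ \<tau>)" for r i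
  proof -
    obtain j where "i = Suc j" "N \<le> j" using i by (cases i) auto
    then show ?thesis using unmentioned[OF N _ r] unmentioned[OF N _ at] by simp
  qed
  have "track (c \<mu>) i = track (c \<alpha>) i" for i
    using const[OF _ mt] eq lim[OF mt m(2)] lim[OF at Limit_alpha] by (cases "i < Suc N") auto
  then have ma: "c \<mu> = c \<alpha>" by (rule config_eqI)
  have om: "Ord \<mu>" using m LimitD by blast
  have "elts \<mu> \<subseteq> elts \<alpha>" using m(1) below_trans by blast
  then obtain d where d: "Ord d" "oadd \<mu> d = \<alpha>" using oadd_surj[OF om Ord_alpha] by blast
  have "elts \<mu> \<subseteq> elts \<tau>" using sub \<open>elts \<mu> \<subseteq> elts \<alpha>\<close> by blast
  then obtain e where e: "Ord e" "oadd \<mu> e = \<tau>" using oadd_surj[OF om Ord_tau] by blast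
  have "\<exists>e'\<in>elts d. c (oadd \<mu> e) = c (oadd \<mu> e')"
  proof (rule loop[OF om d(1)])
    show "d \<noteq> zero" using d(2) m(1) by auto
    show "oadd \<mu> d \<in> elts (succ \<tau>)" using d at by simp
    show "c (oadd \<mu> d) = c \<mu>" using d ma by simp
    show "Ord e" by (rule e)
    show "oadd \<mu> e \<in> elts (succ \<tau>)" using e by simp
    fix f i assume f: "f \<in> elts d"
    let ?r = "oadd \<mu> f"
    have ra: "?r \<in> elts \<alpha>" using oadd_mono[OF f, of \<mu>] d by simp
    have rm: "?r \<notin> elts \<mu>"
    proof
      assume "?r \<in> elts \<mu>"
      then have "?r \<in> elts ?r" by (simp add: elts_oadd[of \<mu> f])
      then show False by simp
    qed
    show "elts (track (c \<mu>) i) \<subseteq> elts (track (c ?r) i)"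
    proof (cases "i < Suc N")
      case True
      have "elts (liminf \<alpha> (T i)) \<subseteq> elts (T i ?r)" using ge True ra rm by blast
      then show ?thesis using lim[OF at Limit_alpha, of i] Tc[OF time_trans[OF at ra], of i] ma by simp
    next
      case False
      then show ?thesis using const[OF False time_trans[OF at ra]] ma by simp
    qed
  qed
  then obtain e' where "e' \<in> elts d" "c \<tau> = c (oadd \<mu> e')" using e by auto
  then have "halted P (c (oadd \<mu> e'))" "oadd \<mu> e' \<in> elts \<alpha>" using h oadd_mono[of e' d \<mu>] d by auto
  then show False using nh sub by blast
qed

lemma (in regular_in_L) not_recognizable:
  assumes x: "x \<in> L" "elts x \<subseteq> elts \<alpha>"
  shows "\<not> wITRM_recognizable \<alpha> x"
proof
  assume "wITRM_recognizable \<alpha> x"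
  then obtain P \<xi> where xi: "\<xi> \<in> elts \<alpha>"
    and rc: "\<And>y. elts y \<subseteq> elts \<alpha> \<Longrightarrow> wITRM_halts_with \<alpha> P y [\<xi>] (if y = x then succ zero else zero)"
    unfolding wITRM_recognizable_def by blast
  obtain \<tau> c where r: "run P x [\<xi>] \<tau> c"
    and bd: "\<And>\<sigma> i. \<sigma> \<in> elts (succ \<tau>) \<Longrightarrow> regs (c \<sigma>) i \<in> elts \<alpha>"
    and h: "halted P (c \<tau>)" and out: "regs (c \<tau>) 0 = succ zero"
    and nh: "\<And>\<sigma>. \<sigma> \<in> elts \<tau> \<Longrightarrow> \<not> halted P (c \<sigma>)"
    using halts_least[OF rc[OF x(2)]] by (simp only: if_True simp_thms) blast
  interpret run P x "[\<xi>]" \<tau> c by (rule r)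
  have "regs (start_config [\<xi>]) i \<in> L" for i
    using Ord_in_L[OF Ord_below[OF xi]] by (simp add: start_config_def)
  then obtain T where T: "\<And>i t. DT t \<Longrightarrow> DT (\<lambda>s. T i (t s))"
    and Tc: "\<And>i s. s \<in> elts (succ \<tau>) \<Longrightarrow> T i s = track (c s) i"
    using definable_tracks[OF x(1)] by blast
  have ta: "\<tau> \<in> elts \<alpha>" by (rule halts_early[OF r x(1) xi bd h nh T Tc])
  obtain N where N: "\<forall>cmd\<in>set P. \<forall>j\<in>cmd_regs cmd. j < N" using ex_reg_bound by blast
  have sa: "succ \<tau> \<in> elts \<alpha>" using LimitD(2)[OF Limit_alpha ta] .
  \<comment> \<open>The domain \<open>succ \<tau>\<close> includes the halting time.
    \<open>Suc N\<close> tracks cover the active line and the registers below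
    \<open>N\<close>.\<close>
  have "\<exists>g\<in>elts \<alpha>. \<forall>i<Suc N. \<forall>s\<in>elts (succ \<tau>). T i s \<in> elts g"
  proof (rule finite_bound[OF Limit_alpha])
    fix i
    have "T i s \<in> elts \<alpha>" if "s \<in> elts (succ \<tau>)" for s
      unfolding Tc[OF that] using bd[OF that] by (cases i) simp_all
    then show "\<exists>g\<in>elts \<alpha>. \<forall>g'\<in>elts \<alpha>. elts g \<subseteq> elts g' \<longrightarrow> (\<forall>s\<in>elts (succ \<tau>). T i s \<in> elts g')"
      using regular_bound[OF T[OF DT_var] sa, of i] by blast
  qed
  then obtain g where g: "g \<in> elts \<alpha>" "\<And>i s. i < Suc N \<Longrightarrow> s \<in> elts (succ \<tau>) \<Longrightarrow> T i s \<in> elts g" by blast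
  \<comment> \<open>\<open>x\<close> with the membership of \<open>g\<close> reversed, so that
    \<open>y\<close> stays a subset of \<alpha> and differs from \<open>x\<close> only at
    \<open>g\<close>.\<close>
  define y where "y = vset (if g \<in> elts x then elts x - {g} else insert g (elts x))"
  have "small (elts x - {g})" by (rule small_subset[OF small_elts]) blast
  then have ey: "elts y = (if g \<in> elts x then elts x - {g} else insert g (elts x))"
    by (simp add: y_def)
  have yx: "y \<noteq> x" using ey by (auto split: if_splits)
  have ya: "elts y \<subseteq> elts \<alpha>" using ey x(2) g(1) by auto
  have "wITRM_halts_with \<alpha> P y [\<xi>] zero" using rc[OF ya] yx by simp
  then obtain \<tau>' c' where r': "run P y [\<xi>] \<tau>' c'" and h': "halted P (c' \<tau>')" and out': "regs (c' \<tau>') 0 = zero"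
    by (rule halts_least) blast
  have same: "c \<sigma> = c' \<sigma>" if s: "\<sigma> \<in> elts (succ \<tau>)" "\<sigma> \<in> elts (succ \<tau>')" for \<sigma>
  proof (rule run_unique[OF r r' _ s])
    fix s cmd j assume sj: "s \<in> elts \<tau>" "cmd \<in> set P" "j \<in> cmd_regs cmd"
    have st: "s \<in> elts (succ \<tau>)" using sj by simp
    have "regs (c s) j \<in> elts g" using g(2)[of "Suc j" s] N sj st Tc[OF st, of "Suc j"] by auto
    then have "regs (c s) j \<noteq> g" by auto
    then show "regs (c s) j \<in> elts x \<longleftrightarrow> regs (c s) j \<in> elts y" using ey by auto
  qed
  have ot': "Ord \<tau>'" using run.Ord_tau[OF r'] .
  \<comment> \<open>Whichever run halts first, the other one is then in the same halted
    configuration and stays in it.\<close>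
  consider "elts \<tau> \<subseteq> elts \<tau>'" | "elts \<tau>' \<subseteq> elts \<tau>"
    using Ord_not_in[OF ot' Ord_tau] Ord_transD[OF Ord_tau] by blast
  then have "c \<tau> = c' \<tau>'"
  proof cases
    case 1
    then have "\<tau> \<in> elts (succ \<tau>')" using Ord_in_succ_iff Ord_tau ot' by blast
    then have "c \<tau> = c' \<tau>" using same by simp
    moreover have "c' \<tau>' = c' \<tau>"
      by (rule run.halted_const[OF r' Ord_tau _ _ 1]) (use h calculation in simp_all)
    ultimately show ?thesis by simp
  next
    case 2
    then have "\<tau>' \<in> elts (succ \<tau>)" using Ord_in_succ_iff Ord_tau ot' by blast
    then have "c \<tau>' = c' \<tau>'" using same by simp
    moreover have "c \<tau> = c \<tau>'"
      by (rule halted_const[OF ot' _ _ 2]) (use h' calculation in simp_all)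
    ultimately show ?thesis by simp
  qed
  then show False using out out' by simp
qed

theorem lemma13:
  fixes \<alpha> :: "'v::zfc_universe"
  assumes "Ord \<alpha>"
    and "uncountable_regular_cardinal_rel L \<alpha>"
  shows "\<not> (\<exists>x\<in>L. elts x \<subseteq> elts \<alpha> \<and> wITRM_recognizable \<alpha> x)"
proof -
  interpret regular_in_L \<alpha> using assms by unfold_locales
  show ?thesis using not_recognizable by blast
qed

end
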